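(* Let $X$ be a birth-and-death continuous-time random walk with embedded Markov chain $(X_k)_{k\ge 0}$ having transition probabilities $p_i,q_i$, and with waiting times $\{\tau_i^+,\tau_i^-\mid i\ge 0\}$, and let $\delta_k$ ($k\ge 0$) and $\nu_i$ ($i\ge 0$) be the associated scale and speed measure. Then for every initial distribution of $X$ the following alternative holds: $$\mathsf P\{X \text{ explodes to } \infty\}=1 \iff \sum_{k=0}^\infty\Big(\sum_{i=0}^k \nu_i\Big)\delta_k<\infty,$$ $$\mathsf P\{X \text{ explodes to } \infty\}=0 \iff \sum_{k=0}^\infty\Big(\sum_{i=0}^k \nu_i\Big)\delta_k=\infty.$$
   Context: Setting. $(X_k)_{k\ge0}$ is a Markov chain on $\{0,1,2,\dots\}$ with transition probabilities $p_{i,i+1}=p_i$, $p_{i,i-1}=q_i$, where $p_0=1$ (so $q_0=0$) and, for $i\ge1$, $p_i>0$, $q_i>0$, $p_i+q_i=1$. For each $i\ge 0$, $\tau_i^+$ and $\tau_i^-$ are (finite) positive random variables (right and left waiting times; their distributions are otherwise arbitrary), and $\{\tau_{i,k}^+\}_{k\ge0}$, $\{\tau_{i,k}^-\}_{k\ge0}$ are sequences of independent copies of $\tau_i^+$, $\tau_i^-$ respectively; all these sequences and the Markov chain $(X_k)$ are independent of each other. Put $T_0=0$ and $T_{k+1}=T_k+\tau^k$ for $k\ge0$, where $\tau^k=\tau_{i,k}^+$ if $X_k=i$ and $X_{k+1}=i+1$, and $\tau^k=\tau_{i,k}^-$ if $X_k=i$ and $X_{k+1}=i-1$. The continuous-time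 random walk is $X(t)=X_k$ for $t\in[T_k,T_{k+1})$, $k\ge0$ (so it is defined for $t<\lim_k T_k$). The initial distribution of $X$ is the law of $X_0$. Explosion. $\sigma_n=\inf\{t\ge0\mid X(t)=n\}$ (with $\inf\emptyset=\infty$), and $\sigma_\infty=\lim_{n\to\infty}\sigma_n$ is the moment of explosion; $X$ explodes to $\infty$ on the event $\{\sigma_\infty<\infty\}$. Scale and speed measure. $\mathsf E e^{-\tau_i}:=p_i\,\mathsf E e^{-\tau_i^+}+q_i\,\mathsf E e^{-\tau_i^-}$ (so $\mathsf E e^{-\tau_0}=\mathsf E e^{-\tau_0^+}$), $$\delta_k=\frac{q_1\cdots q_k}{p_1\cdots p_k},\ k\ge0,\qquad \nu_i=(1-\mathsf E e^{-\tau_i})\,\frac{p_1\cdots p_{i-1}}{q_1\cdots q_i},\ i\ge0,$$ where products over an empty set equal $1$; thus $\delta_0=1$, $\nu_0=1-\mathsf E e^{-\tau_0^+}$, $\nu_1=(1-\mathsf E e^{-\tau_1})/q_1$. *)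

theory Defs
  imports "HOL-Probability.Probability"
begin

definition bd_transition :: "(nat \<Rightarrow> real) \<Rightarrow> (nat \<Rightarrow> real) \<Rightarrow> nat \<Rightarrow> nat \<Rightarrow> real" where
  "bd_transition p q i j = (if j = Suc i then p i else if i = Suc j then q i else 0)"

datatype source = Embedded_Chain | Right_Waits nat | Left_Waits nat

text \<open>
  One process for the embedded chain and one for each sequence of waiting times, so that their
  mutual independence is independence of a single family. The chain is coded with values in the
  reals only because all members of the family must have the same type; it generates the same
  sigma-algebra.
\<close>
fun source_process ::
  "(nat \<Rightarrow> 'a \<Rightarrow> nat) \<Rightarrow> (nat \<Rightarrow> nat \<Rightarrow> 'a \<Rightarrow> real) \<Rightarrow> (nat \<Rightarrow> nat \<Rightarrow> 'a \<Rightarrow> real)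
    \<Rightarrow> source \<Rightarrow> 'a \<Rightarrow> nat \<Rightarrow> real" where
  "source_process X \<tau>ps \<tau>ms Embedded_Chain \<omega> = (\<lambda>k. real (X k \<omega>))"
| "source_process X \<tau>ps \<tau>ms (Right_Waits i) \<omega> = (\<lambda>k. \<tau>ps i k \<omega>)"
| "source_process X \<tau>ps \<tau>ms (Left_Waits i) \<omega> = (\<lambda>k. \<tau>ms i k \<omega>)"

text \<open>
  \<open>\<tau>p i\<close>, \<open>\<tau>m i\<close> are the right and left waiting times at \<open>i\<close>, and \<open>\<tau>ps i k\<close>, \<open>\<tau>ms i k\<close> their
  independent copies. Nothing is assumed on how \<open>\<tau>p i\<close> and \<open>\<tau>m i\<close> depend on each other or on the
  copies; only their laws matter. The law of \<open>X 0\<close>, the initial distribution, is arbitrary.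
\<close>
locale birth_death_ctrw = prob_space M
  for M :: "'a measure" +
  fixes p q :: "nat \<Rightarrow> real"
    and X :: "nat \<Rightarrow> 'a \<Rightarrow> nat"
    and \<tau>p \<tau>m :: "nat \<Rightarrow> 'a \<Rightarrow> real"
    and \<tau>ps \<tau>ms :: "nat \<Rightarrow> nat \<Rightarrow> 'a \<Rightarrow> real"
  assumes p_0: "p 0 = 1" and q_0: "q 0 = 0"
    and p_pos: "\<And>i. i \<ge> 1 \<Longrightarrow> p i > 0"
    and q_pos: "\<And>i. i \<ge> 1 \<Longrightarrow> q i > 0"
    and p_q_sum: "\<And>i. i \<ge> 1 \<Longrightarrow> p i + q i = 1"
    and X_rv: "\<And>k. random_variable (count_space UNIV) (X k)"
    and X_markov: "\<And>k x j. \<P>(\<omega> in M. \<forall>l\<le>k. X l \<omega> = x l) > 0 \<Longrightarrow>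
      \<P>(\<omega> in M. X (Suc k) \<omega> = j \<bar> \<forall>l\<le>k. X l \<omega> = x l) = bd_transition p q (x k) j"
    and \<tau>p_rv: "\<And>i. random_variable borel (\<tau>p i)"
    and \<tau>m_rv: "\<And>i. random_variable borel (\<tau>m i)"
    and \<tau>p_pos: "\<And>i. AE \<omega> in M. \<tau>p i \<omega> > 0"
    and \<tau>m_pos: "\<And>i. AE \<omega> in M. \<tau>m i \<omega> > 0"
    and \<tau>ps_indep: "\<And>i. indep_vars (\<lambda>_. borel) (\<tau>ps i) UNIV"
    and \<tau>ms_indep: "\<And>i. indep_vars (\<lambda>_. borel) (\<tau>ms i) UNIV"
    and \<tau>ps_copy: "\<And>i k. distr M borel (\<tau>ps i k) = distr M borel (\<tau>p i)"
    and \<tau>ms_copy: "\<And>i k. distr M borel (\<tau>ms i k) = distr M borel (\<tau>m i)"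
    and sources_indep:
      "indep_vars (\<lambda>_. PiM UNIV (\<lambda>_::nat. borel)) (source_process X \<tau>ps \<tau>ms) UNIV"

text \<open>The \<open>else\<close> branch is the jump to the left: almost surely, every jump is by one unit.\<close>
fun jump_time ::
  "(nat \<Rightarrow> 'a \<Rightarrow> nat) \<Rightarrow> (nat \<Rightarrow> nat \<Rightarrow> 'a \<Rightarrow> real) \<Rightarrow> (nat \<Rightarrow> nat \<Rightarrow> 'a \<Rightarrow> real)
    \<Rightarrow> nat \<Rightarrow> 'a \<Rightarrow> real" where
  "jump_time X \<tau>ps \<tau>ms 0 \<omega> = 0"
| "jump_time X \<tau>ps \<tau>ms (Suc k) \<omega> = jump_time X \<tau>ps \<tau>ms k \<omega> +
    (if X (Suc k) \<omega> = Suc (X k \<omega>) then \<tau>ps (X k \<omega>) k \<omega> else \<tau>ms (X k \<omega>) k \<omega>)"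

text \<open>
  The walk is undefined (\<open>None\<close>) from the limit of the jump times on. Where the jump times increase
  strictly, hence almost surely, the index \<open>k\<close> below is unique; \<open>LEAST\<close> (rather than \<open>THE\<close>) only
  fixes a measurable choice on the remaining null set.
\<close>
definition ct_walk ::
  "(nat \<Rightarrow> 'a \<Rightarrow> nat) \<Rightarrow> (nat \<Rightarrow> nat \<Rightarrow> 'a \<Rightarrow> real) \<Rightarrow> (nat \<Rightarrow> nat \<Rightarrow> 'a \<Rightarrow> real)
    \<Rightarrow> real \<Rightarrow> 'a \<Rightarrow> nat option" where
  "ct_walk X \<tau>ps \<tau>ms t \<omega> =
    (let T = (\<lambda>k. jump_time X \<tau>ps \<tau>ms k \<omega>) in
     if \<exists>k. T k \<le> t \<and> t < T (Suc k)
     then Some (X (LEAST k. T k \<le> t \<and> t < T (Suc k)) \<omega>)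
     else None)"

definition hitting_time ::
  "(nat \<Rightarrow> 'a \<Rightarrow> nat) \<Rightarrow> (nat \<Rightarrow> nat \<Rightarrow> 'a \<Rightarrow> real) \<Rightarrow> (nat \<Rightarrow> nat \<Rightarrow> 'a \<Rightarrow> real)
    \<Rightarrow> nat \<Rightarrow> 'a \<Rightarrow> ereal" where
  "hitting_time X \<tau>ps \<tau>ms n \<omega> = (INF t \<in> {t. t \<ge> 0 \<and> ct_walk X \<tau>ps \<tau>ms t \<omega> = Some n}. ereal t)"

definition explosion_time ::
  "(nat \<Rightarrow> 'a \<Rightarrow> nat) \<Rightarrow> (nat \<Rightarrow> nat \<Rightarrow> 'a \<Rightarrow> real) \<Rightarrow> (nat \<Rightarrow> nat \<Rightarrow> 'a \<Rightarrow> real)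
    \<Rightarrow> 'a \<Rightarrow> ereal" where
  "explosion_time X \<tau>ps \<tau>ms \<omega> = lim (\<lambda>n. hitting_time X \<tau>ps \<tau>ms n \<omega>)"

definition explodes ::
  "(nat \<Rightarrow> 'a \<Rightarrow> nat) \<Rightarrow> (nat \<Rightarrow> nat \<Rightarrow> 'a \<Rightarrow> real) \<Rightarrow> (nat \<Rightarrow> nat \<Rightarrow> 'a \<Rightarrow> real)
    \<Rightarrow> 'a \<Rightarrow> bool" where
  "explodes X \<tau>ps \<tau>ms \<omega> \<longleftrightarrow> explosion_time X \<tau>ps \<tau>ms \<omega> < \<infinity>"

definition wait_laplace ::
  "'a measure \<Rightarrow> (nat \<Rightarrow> real) \<Rightarrow> (nat \<Rightarrow> real) \<Rightarrow> (nat \<Rightarrow> 'a \<Rightarrow> real) \<Rightarrow> (nat \<Rightarrow> 'a \<Rightarrow> real)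
    \<Rightarrow> nat \<Rightarrow> real" where
  "wait_laplace M p q \<tau>p \<tau>m i =
    p i * (\<integral>\<omega>. exp (- \<tau>p i \<omega>) \<partial>M) + q i * (\<integral>\<omega>. exp (- \<tau>m i \<omega>) \<partial>M)"

definition bd_scale :: "(nat \<Rightarrow> real) \<Rightarrow> (nat \<Rightarrow> real) \<Rightarrow> nat \<Rightarrow> real" where
  "bd_scale p q k = (\<Prod>j=1..k. q j) / (\<Prod>j=1..k. p j)"

definition bd_speed ::
  "'a measure \<Rightarrow> (nat \<Rightarrow> real) \<Rightarrow> (nat \<Rightarrow> real) \<Rightarrow> (nat \<Rightarrow> 'a \<Rightarrow> real) \<Rightarrow> (nat \<Rightarrow> 'a \<Rightarrow> real)
    \<Rightarrow> nat \<Rightarrow> real" where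
  "bd_speed M p q \<tau>p \<tau>m i =
    (1 - wait_laplace M p q \<tau>p \<tau>m i) * ((\<Prod>j=1..<i. p j) / (\<Prod>j=1..i. q j))"

end

theory Submission imports Defs begin

text \<open>
  Let \<open>P\<close> be the transition operator of the embedded chain, let \<open>T k\<close> be the jump times, and for
  \<open>\<theta> \<ge> 0\<close> let \<open>Q f i = p i * a i * f (i + 1) + q i * b i * f (i - 1)\<close>, where \<open>a i\<close> and \<open>b i\<close> are the
  Laplace transforms at \<open>\<theta>\<close> of the right and left waiting times. Independence gives the one-step
  identity: conditionally on the path up to step \<open>k\<close>, the mean of \<open>f (X (k + 1)) * exp (- \<theta> * T (k + 1))\<close>
  is \<open>Q f (X k)\<close> times that of \<open>exp (- \<theta> * T k)\<close> (lemma \<open>one_step\<close>).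

  Let \<open>e = 1 - Q 1\<close>, and let \<open>u\<close> be the function with \<open>u 0 = 0\<close> that solves the Poisson equation
  \<open>P u - u = e\<close>. Only \<open>P\<close> enters on the left, so the increments of \<open>u\<close> are explicit; for \<open>\<theta> = 1\<close> they
  are the terms of the series. The loss \<open>P f - Q f\<close> is at least \<open>e\<close> if \<open>f \<ge> 1\<close> and at
  most \<open>e\<close> if \<open>f \<le> 1\<close>. Hence \<open>f = 1 + u\<close> satisfies \<open>Q f \<le> f\<close>, and \<open>h = 1 - s + u\<close> satisfies
  \<open>h \<le> Q h\<close> whenever \<open>u \<le> s \<le> 1\<close>.

  Almost surely, the walk explodes iff the embedded chain is unbounded and the jump times are
  bounded (lemma \<open>explodes_iff\<close>).

  If the series diverges, take \<open>\<theta> = 1\<close> and stop the supermartingale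
  \<open>f (X k) * exp (- T k)\<close> at the first visit to \<open>N\<close>. Starting from \<open>x\<close>, the level \<open>N\<close> is hit while the jump times stay below \<open>c\<close> with probability at most
  \<open>f x * exp c / f N\<close>, which tends to \<open>0\<close> as \<open>N\<close> grows. So an unbounded chain with bounded jump
  times is a null event.

  If the series converges, the submartingale \<open>h (X k) * exp (- \<theta> * T k)\<close> with \<open>s\<close> the sum of
  the increments of \<open>u\<close> gives \<open>E (exp (- \<theta> * T k)) \<ge> 1 - s\<close> for all \<open>k\<close>, so the jump times are bounded with
  probability at least \<open>1 - s\<close>. By dominated convergence, \<open>s\<close> tends to \<open>0\<close> with \<open>\<theta>\<close>.
  Almost surely, the embedded chain leaves \<open>{0..N}\<close>, because the function \<open>v (N + 1) - v\<close> with \<open>P v - v = 1\<close>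
  decays geometrically in mean along the chain killed when it leaves.
\<close>

section \<open>Discrete potential theory of the embedded chain\<close>

text \<open>
  The terms of the explosion series with an arbitrary function \<open>e\<close> in place of the defect
  \<open>1 - wait_laplace\<close>, and their partial sums.
\<close>

definition bd_green :: "(nat \<Rightarrow> real) \<Rightarrow> (nat \<Rightarrow> real) \<Rightarrow> (nat \<Rightarrow> real) \<Rightarrow> nat \<Rightarrow> real" where
  "bd_green p q e k = (\<Sum>i\<le>k. e i * ((\<Prod>j=1..<i. p j) / (\<Prod>j=1..i. q j))) * bd_scale p q k"

definition bd_potential :: "(nat \<Rightarrow> real) \<Rightarrow> (nat \<Rightarrow> real) \<Rightarrow> (nat \<Rightarrow> real) \<Rightarrow> nat \<Rightarrow> real" where
  "bd_potential p q e n = (\<Sum>k<n. bd_green p q e k)"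

lemma sum_speed_times_scale_eq_green:
  "(\<Sum>i\<le>k. bd_speed M p q \<tau>p \<tau>m i) * bd_scale p q k =
     bd_green p q (\<lambda>i. 1 - wait_laplace M p q \<tau>p \<tau>m i) k"
  by (simp add: bd_green_def bd_speed_def)

text \<open>Transition probabilities on the naturals that are reflecting at \<open>0\<close>.\<close>

locale birth_death_rates =
  fixes p q :: "nat \<Rightarrow> real"
  assumes p_at_0: "p 0 = 1" and q_at_0: "q 0 = 0"
    and p_gt_0: "\<And>i. i \<ge> 1 \<Longrightarrow> p i > 0" and q_gt_0: "\<And>i. i \<ge> 1 \<Longrightarrow> q i > 0"
    and sum_eq_1: "\<And>i. i \<ge> 1 \<Longrightarrow> p i + q i = 1"
begin

lemma p_nonneg: "0 \<le> p i" and q_nonneg: "0 \<le> q i" and p_plus_q: "p i + q i = 1"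
  using p_at_0 q_at_0 p_gt_0[of i] q_gt_0[of i] sum_eq_1[of i] by (cases i; simp)+

lemma bd_green_0: "bd_green p q e 0 = e 0"
  by (simp add: bd_green_def bd_scale_def)

lemma bd_green_Suc: "p (Suc k) * bd_green p q e (Suc k) = e (Suc k) + q (Suc k) * bd_green p q e k"
proof -
  have nz: "\<forall>j\<in>{Suc 0..k}. p j \<noteq> 0" "\<forall>j\<in>{Suc 0..k}. q j \<noteq> 0"
    using p_gt_0 q_gt_0 by force+
  have p: "p (Suc k) > 0" and q: "q (Suc k) > 0"
    using p_gt_0 q_gt_0 by auto
  have sc: "p (Suc k) * bd_scale p q (Suc k) = q (Suc k) * bd_scale p q k"
    using p nz by (simp add: bd_scale_def field_simps)
  \<comment> \<open>The contribution of the new term \<open>e (Suc k)\<close> to the sum is normalised to \<open>1\<close>.\<close>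
  have new: "(\<Prod>j=1..<Suc k. p j) / (\<Prod>j=1..Suc k. q j) * (q (Suc k) * bd_scale p q k) = 1"
    using nz q by (simp add: bd_scale_def atLeastLessThanSuc_atLeastAtMost field_simps)
  have "p (Suc k) * bd_green p q e (Suc k) =
    ((\<Sum>i\<le>k. e i * ((\<Prod>j=1..<i. p j) / (\<Prod>j=1..i. q j))) +
      e (Suc k) * ((\<Prod>j=1..<Suc k. p j) / (\<Prod>j=1..Suc k. q j))) * (p (Suc k) * bd_scale p q (Suc k))"
    unfolding bd_green_def by simp
  also have "\<dots> = q (Suc k) * bd_green p q e k +
      e (Suc k) * ((\<Prod>j=1..<Suc k. p j) / (\<Prod>j=1..Suc k. q j) * (q (Suc k) * bd_scale p q k))"
    unfolding sc bd_green_def by (simp only: distrib_right distrib_left mult_ac)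
  finally show ?thesis
    unfolding new by simp
qed

lemma bd_potential_Suc: "bd_potential p q e (Suc n) = bd_potential p q e n + bd_green p q e n"
  by (simp add: bd_potential_def)

text \<open>
  The potential solves the Poisson equation \<open>P u - u = e\<close> for the transition operator \<open>P\<close> of the
  embedded chain. At \<open>i = 0\<close> the value at \<open>i - 1\<close> is irrelevant because \<open>q 0 = 0\<close>.
\<close>
lemma bd_potential_Poisson:
  "p i * bd_potential p q e (Suc i) + q i * bd_potential p q e (i - 1) = bd_potential p q e i + e i"
proof (cases i)
  case 0
  then show ?thesis
    by (simp add: p_at_0 q_at_0 bd_potential_Suc bd_green_0)
next
  case (Suc k)
  have "p i * bd_potential p q e (Suc i) + q i * bd_potential p q e (i - 1) =
    (p i + q i) * bd_potential p q e k + p i * bd_green p q e k + p i * bd_green p q e (Suc k)"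
    by (simp add: Suc bd_potential_Suc algebra_simps)
  also have "p i * bd_green p q e (Suc k) = e i + q i * bd_green p q e k"
    using bd_green_Suc[of k e] by (simp add: Suc)
  also have "(p i + q i) * bd_potential p q e k + p i * bd_green p q e k + (e i + q i * bd_green p q e k)
    = (p i + q i) * (bd_potential p q e k + bd_green p q e k) + e i"
    by (simp add: algebra_simps)
  finally show ?thesis
    using p_plus_q[of i] by (simp add: Suc bd_potential_Suc)
qed

lemma bd_green_mono:
  assumes "\<And>i. e i \<le> e' i"
  shows "bd_green p q e k \<le> bd_green p q e' k"
  unfolding bd_green_def bd_scale_def
  using assms p_gt_0 q_gt_0
  by (intro mult_right_mono sum_mono divide_nonneg_nonneg prod_nonneg) (auto intro: less_imp_le)

lemma bd_green_nonneg:
  assumes "\<And>i. 0 \<le> e i"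
  shows "0 \<le> bd_green p q e k"
  using bd_green_mono[of "\<lambda>_. 0" e k] assms by (simp add: bd_green_def)

lemma bd_potential_mono:
  assumes "\<And>i. 0 \<le> e i" "m \<le> n"
  shows "bd_potential p q e m \<le> bd_potential p q e n"
  unfolding bd_potential_def
  using assms by (intro sum_mono2) (auto intro: bd_green_nonneg)

lemma bd_potential_nonneg:
  assumes "\<And>i. 0 \<le> e i"
  shows "0 \<le> bd_potential p q e n"
  unfolding bd_potential_def by (intro sum_nonneg bd_green_nonneg assms)

lemma bd_green_gt_0:
  assumes "\<And>i. 0 < e i"
  shows "0 < bd_green p q e k"
proof (cases k)
  case 0
  then show ?thesis using assms by (simp add: bd_green_0)
next
  case (Suc n)
  have "0 < p k * bd_green p q e k"
    using bd_green_Suc[of n e] assms[of k] q_gt_0[of k] bd_green_nonneg[of e n] assms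
    by (auto simp: Suc less_imp_le intro!: add_pos_nonneg)
  then show ?thesis
    using p_gt_0[of k] Suc by (simp add: zero_less_mult_iff)
qed

end

lemma tendsto_bd_green:
  assumes "\<And>i. ((\<lambda>n. e n i) \<longlongrightarrow> e' i) F"
  shows "((\<lambda>n. bd_green p q (e n) k) \<longlongrightarrow> bd_green p q e' k) F"
  unfolding bd_green_def by (intro tendsto_intros assms)

section \<open>Explosion along a single trajectory\<close>

declare jump_time.simps(2) [simp del]

lemma skip_free_hits_level:
  fixes x :: "nat \<Rightarrow> nat"
  assumes step: "\<And>k. x (Suc k) \<le> Suc (x k)" and "x 0 \<le> n" "n \<le> x m"
  shows "\<exists>k\<le>m. x k = n"
  using assms(3)
proof (induction m)
  case 0
  then show ?case using assms(2) by auto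
next
  case (Suc m)
  show ?case
  proof (cases "n \<le> x m")
    case True
    then show ?thesis using Suc.IH le_SucI by blast
  next
    case False
    then have "x (Suc m) = n" using step[of m] Suc.prems by simp
    then show ?thesis by blast
  qed
qed

context
  fixes X :: "nat \<Rightarrow> 'a \<Rightarrow> nat" and \<tau>ps \<tau>ms :: "nat \<Rightarrow> nat \<Rightarrow> 'a \<Rightarrow> real" and \<omega> :: 'a
  assumes unit_steps: "\<And>k. X (Suc k) \<omega> = Suc (X k \<omega>) \<or> X k \<omega> = Suc (X (Suc k) \<omega>)"
    and waits_pos: "\<And>i k. \<tau>ps i k \<omega> > 0" "\<And>i k. \<tau>ms i k \<omega> > 0"
begin

private abbreviation (input) "T \<equiv> \<lambda>k. jump_time X \<tau>ps \<tau>ms k \<omega>"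

lemma jump_time_strict_mono: "strict_mono T"
  by (intro strict_monoI_Suc) (auto simp: waits_pos jump_time.simps)

lemma jump_time_interval_unique:
  assumes "T j \<le> t" "t < T (Suc j)" "T k \<le> t" "t < T (Suc k)"
  shows "j = k"
proof -
  have "j < Suc k" "k < Suc j"
    using assms strict_mono_less[OF jump_time_strict_mono] by (metis le_less_trans)+
  then show ?thesis by simp
qed

lemma ct_walk_eq_Some_iff:
  "ct_walk X \<tau>ps \<tau>ms t \<omega> = Some n \<longleftrightarrow> (\<exists>k. T k \<le> t \<and> t < T (Suc k) \<and> X k \<omega> = n)"
proof -
  have "(LEAST k. T k \<le> t \<and> t < T (Suc k)) = k" if "T k \<le> t" "t < T (Suc k)" for k
    using that by (intro Least_equality) (auto dest: jump_time_interval_unique)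
  then show ?thesis
    unfolding ct_walk_def Let_def by auto
qed

text \<open>The infimum is attained: level \<open>n\<close> is entered at the jump time of the first visit to it.\<close>

lemma hitting_time_eq:
  "hitting_time X \<tau>ps \<tau>ms n \<omega> =
    (if \<exists>k. X k \<omega> = n then ereal (T (LEAST k. X k \<omega> = n)) else \<infinity>)"
proof (cases "\<exists>k. X k \<omega> = n")
  case True
  let ?k = "LEAST k. X k \<omega> = n"
  have hit: "X ?k \<omega> = n" using True by (rule LeastI_ex)
  have mono: "mono T" using jump_time_strict_mono by (rule strict_mono_mono)
  have "hitting_time X \<tau>ps \<tau>ms n \<omega> = ereal (T ?k)"
    unfolding hitting_time_def
  proof (rule antisym)
    have "0 \<le> T ?k" using monoD[OF mono, of 0 ?k] by simp
    moreover have "T ?k < T (Suc ?k)" using strict_monoD[OF jump_time_strict_mono] by blast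
    ultimately show "(INF t\<in>{t. 0 \<le> t \<and> ct_walk X \<tau>ps \<tau>ms t \<omega> = Some n}. ereal t) \<le> ereal (T ?k)"
      using hit by (intro INF_lower) (auto simp only: ct_walk_eq_Some_iff)
    show "ereal (T ?k) \<le> (INF t\<in>{t. 0 \<le> t \<and> ct_walk X \<tau>ps \<tau>ms t \<omega> = Some n}. ereal t)"
    proof (rule INF_greatest)
      fix t assume "t \<in> {t. 0 \<le> t \<and> ct_walk X \<tau>ps \<tau>ms t \<omega> = Some n}"
      then obtain k where k: "T k \<le> t" "X k \<omega> = n"
        unfolding ct_walk_eq_Some_iff by auto
      have "T ?k \<le> T k" using mono Least_le[of "\<lambda>k. X k \<omega> = n"] k(2) by (auto dest: monoD)
      then show "ereal (T ?k) \<le> ereal t" using k(1) by simp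
    qed
  qed
  then show ?thesis using True by simp
next
  case False
  then have "{t. 0 \<le> t \<and> ct_walk X \<tau>ps \<tau>ms t \<omega> = Some n} = {}"
    by (auto simp: ct_walk_eq_Some_iff)
  then show ?thesis using False by (simp only: hitting_time_def) (simp add: top_ereal_def)
qed

text \<open>
  On an unbounded trajectory the levels above \<open>X 0\<close> are hit in increasing order, level \<open>n\<close> not
  before step \<open>n - X 0\<close>, so that the hitting times converge, to the limit of the jump times or to \<open>\<infinity>\<close>.
\<close>
lemma explodes_iff:
  "explodes X \<tau>ps \<tau>ms \<omega> \<longleftrightarrow> (\<forall>n. \<exists>k. n \<le> X k \<omega>) \<and> (\<exists>c. \<forall>k. T k \<le> c)"
proof (cases "\<forall>n. \<exists>k. n \<le> X k \<omega>")
  case False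
  then obtain N where N: "\<And>k. X k \<omega> < N" by (auto simp: not_le)
  have "hitting_time X \<tau>ps \<tau>ms n \<omega> = \<infinity>" if "n \<ge> N" for n
    using N that by (auto simp: hitting_time_eq) (metis not_le)
  then have "(\<lambda>n. hitting_time X \<tau>ps \<tau>ms n \<omega>) \<longlonglongrightarrow> \<infinity>"
    by (intro tendsto_eventually) (auto simp: eventually_sequentially)
  then show ?thesis
    using False by (simp add: explodes_def explosion_time_def limI)
next
  case True
  have step: "X (Suc k) \<omega> \<le> Suc (X k \<omega>)" for k using unit_steps[of k] by auto
  have hit: "\<exists>k. X k \<omega> = n" if "n \<ge> X 0 \<omega>" for n
    using skip_free_hits_level[of "\<lambda>k. X k \<omega>", OF step] True that by meson
  define \<theta> where "\<theta> n = (LEAST k. X k \<omega> = n)" for n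
  have \<theta>: "X (\<theta> n) \<omega> = n" if "n \<ge> X 0 \<omega>" for n
    unfolding \<theta>_def using hit[OF that] by (rule LeastI_ex)
  have bound: "X k \<omega> \<le> X 0 \<omega> + k" for k
    by (induction k) (use step le_trans in fastforce)+
  have \<theta>_ge: "n \<le> X 0 \<omega> + \<theta> n" if "n \<ge> X 0 \<omega>" for n
    using bound[of "\<theta> n"] \<theta>[OF that] by simp
  have mono: "mono T" using jump_time_strict_mono by (rule strict_mono_mono)
  have T_\<theta>: "hitting_time X \<tau>ps \<tau>ms n \<omega> = ereal (T (\<theta> n))" if "n \<ge> X 0 \<omega>" for n
    using hit[OF that] by (simp only: hitting_time_eq \<theta>_def if_True)
  have "filterlim (\<lambda>n. n - X 0 \<omega>) at_top sequentially"
    by (rule filterlim_minus_const_nat_at_top)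
  then have \<theta>_lim: "filterlim \<theta> at_top sequentially"
    by (rule filterlim_at_top_mono) (use \<theta>_ge in \<open>force intro!: eventually_sequentiallyI[of "X 0 \<omega>"]\<close>)
  have "(\<lambda>k. ereal (T k)) \<longlonglongrightarrow> (SUP k. ereal (T k))"
    using mono by (intro LIMSEQ_SUP) (auto simp: incseq_def mono_def)
  from filterlim_compose[OF this \<theta>_lim]
  have "(\<lambda>n. hitting_time X \<tau>ps \<tau>ms n \<omega>) \<longlonglongrightarrow> (SUP k. ereal (T k))"
    by (rule Lim_transform_eventually)
      (use T_\<theta> in \<open>force intro!: eventually_sequentiallyI[of "X 0 \<omega>"]\<close>)
  then have "explodes X \<tau>ps \<tau>ms \<omega> \<longleftrightarrow> (SUP k. ereal (T k)) < \<infinity>"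
    by (simp add: explodes_def explosion_time_def limI)
  also have "\<dots> \<longleftrightarrow> (\<exists>c. \<forall>k. T k \<le> c)"
  proof
    assume fin: "(SUP k. ereal (T k)) < \<infinity>"
    have "ereal (T 0) \<le> (SUP k. ereal (T k))" by (rule SUP_upper) simp
    with fin obtain c where c: "(SUP k. ereal (T k)) = ereal c"
      by (cases "SUP k. ereal (T k)") auto
    have "T k \<le> c" for k
      using SUP_upper[of k UNIV "\<lambda>k. ereal (T k)"] unfolding c by simp
    then show "\<exists>c. \<forall>k. T k \<le> c" by blast
  next
    assume "\<exists>c. \<forall>k. T k \<le> c"
    then obtain c where "\<And>k. T k \<le> c" by blast
    then have "(SUP k. ereal (T k)) \<le> ereal c" by (intro SUP_least) simp
    then show "(SUP k. ereal (T k)) < \<infinity>" using le_less_trans[of _ "ereal c" \<infinity>] by simp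
  qed
  finally show ?thesis using True by simp
qed

end

section \<open>Measurability of the explosion event\<close>

text \<open>
  Neither this lemma nor the following ones assume that the jump times increase: measurability of
  the explosion event concerns every point of the probability space. Right continuity reduces the
  infimum over all times that defines the hitting time to rational times.
\<close>

lemma ct_walk_right_continuous:
  assumes "ct_walk X \<tau>ps \<tau>ms t \<omega> = Some n"
  shows "eventually (\<lambda>s. ct_walk X \<tau>ps \<tau>ms s \<omega> = Some n) (at_right t)"
proof -
  let ?P = "\<lambda>s k. jump_time X \<tau>ps \<tau>ms k \<omega> \<le> s \<and> s < jump_time X \<tau>ps \<tau>ms (Suc k) \<omega>"
  have ex: "\<exists>k. ?P t k" and n: "X (LEAST k. ?P t k) \<omega> = n"
    using assms unfolding ct_walk_def Let_def by (auto split: if_splits)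
  define k where "k = (LEAST k. ?P t k)"
  have k: "?P t k" unfolding k_def using ex by (rule LeastI_ex)
  have least: "\<not> ?P t j" if "j < k" for j
    using that not_less_Least unfolding k_def by blast
  have gt: "eventually (\<lambda>s. t < s) (at_right t)"
    by (simp add: eventually_at_right_less)
  have lt: "eventually (\<lambda>s. s < u) (at_right t)" if "t < u" for u
    using that eventually_at_right by blast
  have "eventually (\<lambda>s. ?P s k) (at_right t)"
    using gt lt[of "jump_time X \<tau>ps \<tau>ms (Suc k) \<omega>"] k
    by (auto elim: eventually_elim2)
  moreover have "eventually (\<lambda>s. \<forall>j\<in>{..<k}. \<not> ?P s j) (at_right t)"
  proof (rule eventually_ball_finite, simp, rule ballI)
    fix j assume "j \<in> {..<k}"
    then consider "t < jump_time X \<tau>ps \<tau>ms j \<omega>" | "jump_time X \<tau>ps \<tau>ms (Suc j) \<omega> \<le> t"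
      using least[of j] by (auto simp: not_le not_less)
    then show "eventually (\<lambda>s. \<not> ?P s j) (at_right t)"
    proof cases
      case 1
      from lt[OF this] show ?thesis by (rule eventually_mono) auto
    next
      case 2
      from gt show ?thesis by (rule eventually_mono) (use 2 in \<open>auto\<close>)
    qed
  qed
  ultimately show ?thesis
  proof eventually_elim
    case (elim s)
    have "(LEAST k. ?P s k) = k"
      using elim by (intro Least_equality) (auto simp: not_less[symmetric])
    then show ?case
      using elim(1) n unfolding ct_walk_def Let_def k_def by auto
  qed
qed

lemma hitting_time_less_iff:
  "hitting_time X \<tau>ps \<tau>ms n \<omega> < y \<longleftrightarrow>
    (\<exists>r::rat. 0 \<le> r \<and> ereal (of_rat r) < y \<and> ct_walk X \<tau>ps \<tau>ms (of_rat r) \<omega> = Some n)"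
proof
  assume "hitting_time X \<tau>ps \<tau>ms n \<omega> < y"
  then obtain t where t: "0 \<le> t" "ct_walk X \<tau>ps \<tau>ms t \<omega> = Some n" "ereal t < y"
    unfolding hitting_time_def INF_less_iff by auto
  from t(3) obtain y' where y': "t < y'" "ereal y' \<le> y"
    by (metis ereal_dense2 ereal_less(2) ereal_less_eq(3) less_ereal.simps(1) less_imp_le)
  obtain b where b: "t < b" "\<And>s. t < s \<Longrightarrow> s < b \<Longrightarrow> ct_walk X \<tau>ps \<tau>ms s \<omega> = Some n"
    using ct_walk_right_continuous[OF t(2)] unfolding eventually_at_right_field by blast
  obtain r :: rat where r: "t < of_rat r" "of_rat r < min b y'"
    using of_rat_dense[of t "min b y'"] b(1) y'(1) by auto
  have "0 \<le> r" using r(1) t(1) by (metis less_imp_le order_trans zero_le_of_rat_iff)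
  moreover have "ereal (of_rat r) < y"
    using r(2) y'(2) by (auto intro: less_le_trans[of _ "ereal y'"])
  ultimately show "\<exists>r::rat. 0 \<le> r \<and> ereal (of_rat r) < y \<and> ct_walk X \<tau>ps \<tau>ms (of_rat r) \<omega> = Some n"
    using r b(2) by auto
next
  assume "\<exists>r::rat. 0 \<le> r \<and> ereal (of_rat r) < y \<and> ct_walk X \<tau>ps \<tau>ms (of_rat r) \<omega> = Some n"
  then obtain r :: rat where "0 \<le> r" "ereal (of_rat r) < y" "ct_walk X \<tau>ps \<tau>ms (of_rat r) \<omega> = Some n"
    by blast
  then show "hitting_time X \<tau>ps \<tau>ms n \<omega> < y"
    unfolding hitting_time_def INF_less_iff by (intro bexI[of _ "of_rat r"]) auto
qed

text \<open>The limit of a divergent sequence has a fixed though unspecified value.\<close>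

lemma lim_eq_liminf_or_default:
  fixes u :: "nat \<Rightarrow> ereal"
  shows "lim u = (if limsup u = liminf u then liminf u else (THE l. False))"
proof (cases "convergent u")
  case True
  then show ?thesis by (metis convergent_ereal convergent_liminf_cl)
next
  case False
  then show ?thesis
    by (auto simp: lim_def convergent_ereal[symmetric] convergent_def)
qed

context
  fixes M :: "'a measure" and X :: "nat \<Rightarrow> 'a \<Rightarrow> nat" and \<tau>ps \<tau>ms :: "nat \<Rightarrow> nat \<Rightarrow> 'a \<Rightarrow> real"
  assumes X_meas [measurable]: "\<And>k. X k \<in> measurable M (count_space UNIV)"
    and \<tau>ps_meas [measurable]: "\<And>i k. \<tau>ps i k \<in> borel_measurable M"
    and \<tau>ms_meas [measurable]: "\<And>i k. \<tau>ms i k \<in> borel_measurable M"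
begin

lemma jump_time_measurable: "jump_time X \<tau>ps \<tau>ms k \<in> borel_measurable M"
proof (induction k)
  case (Suc k)
  have [measurable]: "jump_time X \<tau>ps \<tau>ms k \<in> borel_measurable M" by (rule Suc)
  have "Measurable.pred M (\<lambda>\<omega>. \<exists>i. X k \<omega> = i \<and> X (Suc k) \<omega> = Suc i)" by measurable
  then have right: "Measurable.pred M (\<lambda>\<omega>. X (Suc k) \<omega> = Suc (X k \<omega>))" by simp
  have p: "(\<lambda>\<omega>. \<tau>ps (X k \<omega>) k \<omega>) \<in> borel_measurable M"
    by (rule measurable_compose_countable[OF \<tau>ps_meas X_meas])
  have m: "(\<lambda>\<omega>. \<tau>ms (X k \<omega>) k \<omega>) \<in> borel_measurable M"
    by (rule measurable_compose_countable[OF \<tau>ms_meas X_meas])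
  have "(\<lambda>\<omega>. jump_time X \<tau>ps \<tau>ms (Suc k) \<omega>) \<in> borel_measurable M"
    unfolding jump_time.simps by (intro borel_measurable_add measurable_If p m Suc right[unfolded pred_def])
  then show ?case .
next
  case 0
  have "jump_time X \<tau>ps \<tau>ms 0 = (\<lambda>_. 0)" by (rule ext) simp
  then show ?case by simp
qed

lemma hitting_time_measurable: "hitting_time X \<tau>ps \<tau>ms n \<in> borel_measurable M"
proof (rule borel_measurableI_less)
  fix y
  note jump_time_measurable [measurable]
  have "Measurable.pred M (\<lambda>\<omega>. ct_walk X \<tau>ps \<tau>ms t \<omega> = Some n)" for t
  proof -
    have "(\<lambda>\<omega>. X (LEAST k. jump_time X \<tau>ps \<tau>ms k \<omega> \<le> t \<and> t < jump_time X \<tau>ps \<tau>ms (Suc k) \<omega>) \<omega>)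
        \<in> measurable M (count_space UNIV)"
      by (rule measurable_compose_countable[OF X_meas]) measurable
    then have [measurable]: "Measurable.pred M
        (\<lambda>\<omega>. X (LEAST k. jump_time X \<tau>ps \<tau>ms k \<omega> \<le> t \<and> t < jump_time X \<tau>ps \<tau>ms (Suc k) \<omega>) \<omega> = n)"
      by measurable
    have "(\<lambda>\<omega>. ct_walk X \<tau>ps \<tau>ms t \<omega> = Some n) = (\<lambda>\<omega>.
        (\<exists>k. jump_time X \<tau>ps \<tau>ms k \<omega> \<le> t \<and> t < jump_time X \<tau>ps \<tau>ms (Suc k) \<omega>) \<and>
        X (LEAST k. jump_time X \<tau>ps \<tau>ms k \<omega> \<le> t \<and> t < jump_time X \<tau>ps \<tau>ms (Suc k) \<omega>) \<omega> = n)"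
      unfolding ct_walk_def Let_def by auto
    then show ?thesis by simp
  qed
  note this [measurable]
  show "{\<omega> \<in> space M. hitting_time X \<tau>ps \<tau>ms n \<omega> < y} \<in> sets M"
    unfolding hitting_time_less_iff by measurable
qed

lemma explodes_measurable: "Measurable.pred M (explodes X \<tau>ps \<tau>ms)"
proof -
  note hitting_time_measurable [measurable]
  have "explodes X \<tau>ps \<tau>ms = (\<lambda>\<omega>.
      (if limsup (\<lambda>n. hitting_time X \<tau>ps \<tau>ms n \<omega>) = liminf (\<lambda>n. hitting_time X \<tau>ps \<tau>ms n \<omega>)
       then liminf (\<lambda>n. hitting_time X \<tau>ps \<tau>ms n \<omega>) else (THE l. False)) < \<infinity>)"
    by (simp add: fun_eq_iff explodes_def explosion_time_def lim_eq_liminf_or_default)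
  then show ?thesis by simp
qed

end

section \<open>The one-step identity for exponentially weighted paths\<close>

text \<open>Two integrals agree if they agree over every fibre of a countably valued map.\<close>

lemma nn_integral_eq_by_fibres:
  fixes Z :: "'a \<Rightarrow> 'b::countable"
  assumes Z [measurable]: "Z \<in> measurable M (count_space UNIV)"
    and U [measurable]: "U \<in> borel_measurable M" and V [measurable]: "V \<in> borel_measurable M"
    and eq: "\<And>z. (\<integral>\<^sup>+\<omega>. indicator {z} (Z \<omega>) * U \<omega> \<partial>M) = (\<integral>\<^sup>+\<omega>. indicator {z} (Z \<omega>) * V \<omega> \<partial>M)"
  shows "(\<integral>\<^sup>+\<omega>. U \<omega> \<partial>M) = (\<integral>\<^sup>+\<omega>. V \<omega> \<partial>M)"
proof -
  have decomp: "(\<integral>\<^sup>+\<omega>. W \<omega> \<partial>M) =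
      (\<integral>\<^sup>+z. \<integral>\<^sup>+\<omega>. indicator {z} (Z \<omega>) * W \<omega> \<partial>M \<partial>count_space UNIV)"
    if [measurable]: "W \<in> borel_measurable M" for W :: "'a \<Rightarrow> ennreal"
  proof -
    have "W \<omega> = (\<integral>\<^sup>+z. indicator {z} (Z \<omega>) * W \<omega> \<partial>count_space UNIV)" for \<omega>
    proof -
      have "(\<integral>\<^sup>+z. indicator {z} (Z \<omega>) * W \<omega> \<partial>count_space UNIV) =
          (\<integral>\<^sup>+z. W \<omega> * indicator {Z \<omega>} z \<partial>count_space UNIV)"
        by (intro nn_integral_cong) (auto split: split_indicator)
      then show ?thesis by (simp add: nn_integral_cmult_indicator)
    qed
    then have "(\<integral>\<^sup>+\<omega>. W \<omega> \<partial>M) =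
        (\<integral>\<^sup>+\<omega>. \<integral>\<^sup>+z. indicator {z} (Z \<omega>) * W \<omega> \<partial>count_space UNIV \<partial>M)"
      by simp
    also have "\<dots> = (\<integral>\<^sup>+z. \<integral>\<^sup>+\<omega>. indicator {z} (Z \<omega>) * W \<omega> \<partial>M \<partial>count_space UNIV)"
      by (rule nn_integral_count_space_nn_integral) auto
    finally show ?thesis .
  qed
  show ?thesis
    by (subst (1 2) decomp) (simp_all add: eq)
qed

sublocale birth_death_ctrw \<subseteq> birth_death_rates p q
  using p_0 q_0 p_pos q_pos p_q_sum by unfold_locales

context birth_death_ctrw
begin

abbreviation (input) "T \<equiv> jump_time X \<tau>ps \<tau>ms"

text \<open>Laplace transforms of the waiting times to the right and to the left of \<open>i\<close>.\<close>

definition right_laplace :: "real \<Rightarrow> nat \<Rightarrow> real" where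
  "right_laplace \<theta> i = (\<integral>\<omega>. exp (- \<theta> * \<tau>p i \<omega>) \<partial>M)"

definition left_laplace :: "real \<Rightarrow> nat \<Rightarrow> real" where
  "left_laplace \<theta> i = (\<integral>\<omega>. exp (- \<theta> * \<tau>m i \<omega>) \<partial>M)"

lemma \<tau>ps_rv: "random_variable borel (\<tau>ps i k)"
  using \<tau>ps_indep[of i] by (auto simp: indep_vars_def)

lemma \<tau>ms_rv: "random_variable borel (\<tau>ms i k)"
  using \<tau>ms_indep[of i] by (auto simp: indep_vars_def)

lemmas ctrw_rvs [measurable] = X_rv \<tau>p_rv \<tau>m_rv \<tau>ps_rv \<tau>ms_rv

lemma T_rv [measurable]: "random_variable borel (T k)"
  by (rule jump_time_measurable) measurable

lemma AE_pos_copy: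
  assumes Y [measurable]: "random_variable borel Y" and Y' [measurable]: "random_variable borel Y'"
    and "distr M borel Y' = distr M borel Y" "AE \<omega> in M. Y \<omega> > (0::real)"
  shows "AE \<omega> in M. Y' \<omega> > 0"
proof -
  have "AE y in distr M borel Y. y > 0"
    using assms(4) by (subst AE_distr_iff) auto
  then have "AE y in distr M borel Y'. y > 0" unfolding assms(3) .
  then show ?thesis by (subst (asm) AE_distr_iff) auto
qed

lemma AE_waits_pos: "AE \<omega> in M. \<forall>i k. \<tau>ps i k \<omega> > 0 \<and> \<tau>ms i k \<omega> > 0"
proof -
  have "AE \<omega> in M. \<tau>ps i k \<omega> > 0" "AE \<omega> in M. \<tau>ms i k \<omega> > 0" for i k
    by (rule AE_pos_copy[OF \<tau>p_rv \<tau>ps_rv \<tau>ps_copy \<tau>p_pos],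
        rule AE_pos_copy[OF \<tau>m_rv \<tau>ms_rv \<tau>ms_copy \<tau>m_pos])
  then show ?thesis by (simp add: AE_all_countable)
qed

lemma laplace_props:
  assumes Y [measurable]: "random_variable borel Y" and pos: "AE \<omega> in M. Y \<omega> > (0::real)" and "\<theta> \<ge> 0"
  shows "integrable M (\<lambda>\<omega>. exp (- \<theta> * Y \<omega>))"
    and "0 \<le> (\<integral>\<omega>. exp (- \<theta> * Y \<omega>) \<partial>M)" and "(\<integral>\<omega>. exp (- \<theta> * Y \<omega>) \<partial>M) \<le> 1"
    and "(\<integral>\<^sup>+\<omega>. ennreal (exp (- \<theta> * Y \<omega>)) \<partial>M) = ennreal (\<integral>\<omega>. exp (- \<theta> * Y \<omega>) \<partial>M)"
proof -
  have le1: "AE \<omega> in M. exp (- \<theta> * Y \<omega>) \<le> 1"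
    using pos by eventually_elim (use \<open>\<theta> \<ge> 0\<close> in simp)
  show int: "integrable M (\<lambda>\<omega>. exp (- \<theta> * Y \<omega>))"
    by (rule integrable_const_bound[where B = 1]) (use le1 in auto)
  show "0 \<le> (\<integral>\<omega>. exp (- \<theta> * Y \<omega>) \<partial>M)" by (rule integral_nonneg_AE) simp
  have "(\<integral>\<omega>. exp (- \<theta> * Y \<omega>) \<partial>M) \<le> (\<integral>\<omega>. 1 \<partial>M)"
    by (rule integral_mono_AE) (use int le1 in auto)
  then show "(\<integral>\<omega>. exp (- \<theta> * Y \<omega>) \<partial>M) \<le> 1" by (simp add: prob_space)
  show "(\<integral>\<^sup>+\<omega>. ennreal (exp (- \<theta> * Y \<omega>)) \<partial>M) = ennreal (\<integral>\<omega>. exp (- \<theta> * Y \<omega>) \<partial>M)"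
    by (rule nn_integral_eq_integral[OF int]) simp
qed

lemma laplace_copy:
  assumes Y [measurable]: "random_variable borel Y" and Y' [measurable]: "random_variable borel Y'"
    and "distr M borel Y' = distr M borel Y"
  shows "(\<integral>\<^sup>+\<omega>. ennreal (exp (- \<theta> * Y' \<omega>)) \<partial>M) = (\<integral>\<^sup>+\<omega>. ennreal (exp (- \<theta> * Y \<omega>)) \<partial>M)"
proof -
  have "(\<integral>\<^sup>+\<omega>. ennreal (exp (- \<theta> * Y' \<omega>)) \<partial>M) = (\<integral>\<^sup>+y. ennreal (exp (- \<theta> * y)) \<partial>distr M borel Y')"
    by (subst nn_integral_distr) auto
  also have "\<dots> = (\<integral>\<^sup>+\<omega>. ennreal (exp (- \<theta> * Y \<omega>)) \<partial>M)"
    unfolding assms(3) by (subst nn_integral_distr) auto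
  finally show ?thesis .
qed

lemma laplace_bounds:
  assumes "\<theta> \<ge> 0"
  shows "0 \<le> right_laplace \<theta> i" "right_laplace \<theta> i \<le> 1" "0 \<le> left_laplace \<theta> i" "left_laplace \<theta> i \<le> 1"
  unfolding right_laplace_def left_laplace_def
  using laplace_props(2,3)[OF \<tau>p_rv \<tau>p_pos assms] laplace_props(2,3)[OF \<tau>m_rv \<tau>m_pos assms] by auto

text \<open>
  The source and the Laplace transform of the waiting time before the jump from \<open>i\<close> to \<open>j\<close>. As in
  the jump times, every jump that does not go to \<open>i + 1\<close> counts as a jump to the left.
\<close>

definition jump_source :: "nat \<Rightarrow> nat \<Rightarrow> source" where
  "jump_source i j = (if j = Suc i then Right_Waits i else Left_Waits i)"

definition jump_laplace :: "real \<Rightarrow> nat \<Rightarrow> nat \<Rightarrow> real" where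
  "jump_laplace \<theta> i j = (if j = Suc i then right_laplace \<theta> i else left_laplace \<theta> i)"

lemma jump_laplace_nonneg: "\<theta> \<ge> 0 \<Longrightarrow> 0 \<le> jump_laplace \<theta> i j"
  unfolding jump_laplace_def by (simp add: laplace_bounds)

abbreviation (input) "Src \<equiv> source_process X \<tau>ps \<tau>ms"

lemma nn_integral_jump_source:
  assumes "\<theta> \<ge> 0"
  shows "(\<integral>\<^sup>+\<omega>. ennreal (exp (- \<theta> * Src (jump_source i j) \<omega> k)) \<partial>M) = ennreal (jump_laplace \<theta> i j)"
  unfolding jump_laplace_def right_laplace_def left_laplace_def jump_source_def
  using laplace_props(4)[OF \<tau>p_rv \<tau>p_pos assms] laplace_props(4)[OF \<tau>m_rv \<tau>m_pos assms]
    laplace_copy[OF \<tau>p_rv \<tau>ps_rv \<tau>ps_copy, of \<theta> i k] laplace_copy[OF \<tau>m_rv \<tau>ms_rv \<tau>ms_copy, of \<theta> i k]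
  by simp

lemma indep_within_source:
  assumes "s \<noteq> Embedded_Chain"
  shows "indep_vars (\<lambda>_. borel) (\<lambda>k \<omega>. Src s \<omega> k) UNIV"
  using assms \<tau>ps_indep \<tau>ms_indep by (cases s) auto

text \<open>The embedded chain follows \<open>x\<close> up to step \<open>k\<close>.\<close>

definition path_event :: "(nat \<Rightarrow> nat) \<Rightarrow> nat \<Rightarrow> 'a set" where
  "path_event x k = {\<omega> \<in> space M. \<forall>l\<le>k. X l \<omega> = x l}"

lemma path_event_sets [measurable]: "path_event x k \<in> events"
  unfolding path_event_def by measurable

lemma jump_time_on_path:
  assumes "\<omega> \<in> path_event x k"
  shows "n \<le> k \<Longrightarrow> T n \<omega> = (\<Sum>j<n. Src (jump_source (x j) (x (Suc j))) \<omega> j)"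
proof (induction n)
  case (Suc n)
  have "X n \<omega> = x n" "X (Suc n) \<omega> = x (Suc n)"
    using assms Suc.prems by (auto simp: path_event_def)
  then show ?case using Suc by (simp add: jump_time.simps jump_source_def)
qed simp

text \<open>
  Independence holds on two levels, between the sources and between the copies within one source of
  waiting times. The factors are therefore grouped by their source \<open>s j\<close>.
\<close>

lemma nn_integral_product_over_sources:
  assumes J: "finite J" and s: "\<And>j. j \<in> J \<Longrightarrow> s j \<noteq> Embedded_Chain"
    and g [measurable]: "g \<in> borel_measurable borel"
    and h [measurable]: "h \<in> borel_measurable (PiM UNIV (\<lambda>_::nat. borel))"
  shows "(\<integral>\<^sup>+\<omega>. h (Src Embedded_Chain \<omega>) * (\<Prod>j\<in>J. g (Src (s j) \<omega> j)) \<partial>M) =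
    (\<integral>\<^sup>+\<omega>. h (Src Embedded_Chain \<omega>) \<partial>M) * (\<Prod>j\<in>J. \<integral>\<^sup>+\<omega>. g (Src (s j) \<omega> j) \<partial>M)"
proof -
  let ?S = "insert Embedded_Chain (s ` J)"
  let ?J = "\<lambda>r. {j \<in> J. s j = r}"
  define H :: "source \<Rightarrow> (nat \<Rightarrow> real) \<Rightarrow> ennreal" where
    "H r = (if r = Embedded_Chain then h else (\<lambda>y. \<Prod>j\<in>?J r. g (y j)))" for r
  have notin: "Embedded_Chain \<notin> s ` J" using s by (metis imageE)
  have H_waits: "H r = (\<lambda>y. \<Prod>j\<in>?J r. g (y j))" if "r \<in> s ` J" for r
  proof -
    have "r \<noteq> Embedded_Chain" using that notin by metis
    then show ?thesis by (simp add: H_def)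
  qed
  have H_meas: "H r \<in> borel_measurable (PiM UNIV (\<lambda>_. borel))" for r
    unfolding H_def by (cases "r = Embedded_Chain") (simp_all, measurable)
  have indep: "indep_vars (\<lambda>_. borel) (\<lambda>r \<omega>. H r (Src r \<omega>)) ?S"
    by (rule indep_vars_compose2[OF indep_vars_subset[OF sources_indep] H_meas]) simp
  have within: "(\<integral>\<^sup>+\<omega>. H r (Src r \<omega>) \<partial>M) = (\<Prod>j\<in>?J r. \<integral>\<^sup>+\<omega>. g (Src (s j) \<omega> j) \<partial>M)"
    if r: "r \<in> s ` J" for r
  proof -
    have wait: "r \<noteq> Embedded_Chain" using r notin by metis
    have "indep_vars (\<lambda>_. borel) (\<lambda>j \<omega>. g (Src r \<omega> j)) (?J r)"
      by (rule indep_vars_compose2[OF indep_vars_subset[OF indep_within_source[OF wait]] g]) simp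
    then have "(\<integral>\<^sup>+\<omega>. (\<Prod>j\<in>?J r. g (Src r \<omega> j)) \<partial>M) = (\<Prod>j\<in>?J r. \<integral>\<^sup>+\<omega>. g (Src r \<omega> j) \<partial>M)"
      by (intro indep_vars_nn_integral) (use J in auto)
    then show ?thesis using H_waits[OF r] by simp
  qed
  have "h (Src Embedded_Chain \<omega>) * (\<Prod>j\<in>J. g (Src (s j) \<omega> j)) = (\<Prod>r\<in>?S. H r (Src r \<omega>))" for \<omega>
  proof -
    have "(\<Prod>r\<in>s ` J. H r (Src r \<omega>)) = (\<Prod>r\<in>s ` J. \<Prod>j\<in>?J r. g (Src (s j) \<omega> j))"
      by (intro prod.cong refl) (simp add: H_waits)
    also have "\<dots> = (\<Prod>j\<in>J. g (Src (s j) \<omega> j))"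
      using J by (intro prod.group) auto
    finally show ?thesis
      using J notin by (simp add: H_def)
  qed
  then have "(\<integral>\<^sup>+\<omega>. h (Src Embedded_Chain \<omega>) * (\<Prod>j\<in>J. g (Src (s j) \<omega> j)) \<partial>M) =
      (\<integral>\<^sup>+\<omega>. (\<Prod>r\<in>?S. H r (Src r \<omega>)) \<partial>M)"
    by (simp only:)
  also have "\<dots> = (\<Prod>r\<in>?S. \<integral>\<^sup>+\<omega>. H r (Src r \<omega>) \<partial>M)"
    using J indep by (intro indep_vars_nn_integral) auto
  also have "\<dots> = (\<integral>\<^sup>+\<omega>. h (Src Embedded_Chain \<omega>) \<partial>M) *
      (\<Prod>r\<in>s ` J. \<Prod>j\<in>?J r. \<integral>\<^sup>+\<omega>. g (Src (s j) \<omega> j) \<partial>M)"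
    using J notin within by (simp add: H_def)
  also have "(\<Prod>r\<in>s ` J. \<Prod>j\<in>?J r. \<integral>\<^sup>+\<omega>. g (Src (s j) \<omega> j) \<partial>M) =
      (\<Prod>j\<in>J. \<integral>\<^sup>+\<omega>. g (Src (s j) \<omega> j) \<partial>M)"
    using J by (intro prod.group) auto
  finally show ?thesis .
qed

text \<open>
  The waiting times used along a given path carry distinct indices \<open>j\<close>, so they are independent of
  each other and of the chain.
\<close>

lemma nn_integral_path:
  assumes "\<theta> \<ge> 0" "n \<le> k"
  shows "(\<integral>\<^sup>+\<omega>. indicator (path_event x k) \<omega> * ennreal (exp (- \<theta> * T n \<omega>)) \<partial>M) =
    emeasure M (path_event x k) * (\<Prod>j<n. ennreal (jump_laplace \<theta> (x j) (x (Suc j))))"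
proof -
  define h :: "(nat \<Rightarrow> real) \<Rightarrow> ennreal" where "h y = indicator {y. \<forall>l\<le>k. y l = real (x l)} y" for y
  let ?s = "\<lambda>j. jump_source (x j) (x (Suc j))"
  have h_meas: "h \<in> borel_measurable (PiM UNIV (\<lambda>_::nat. borel))"
  proof -
    have "{y \<in> space (PiM UNIV (\<lambda>_::nat. borel)). \<forall>l\<le>k. y l = real (x l)} \<in> sets (PiM UNIV (\<lambda>_::nat. borel :: real measure))"
      by measurable
    then show ?thesis unfolding h_def[abs_def] by (auto simp: space_PiM intro!: borel_measurable_indicator)
  qed
  have h_chain: "h (Src Embedded_Chain \<omega>) = indicator (path_event x k) \<omega>" if "\<omega> \<in> space M" for \<omega>
    using that by (auto simp: h_def path_event_def split: split_indicator)
  have "(\<integral>\<^sup>+\<omega>. indicator (path_event x k) \<omega> * ennreal (exp (- \<theta> * T n \<omega>)) \<partial>M) =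
    (\<integral>\<^sup>+\<omega>. h (Src Embedded_Chain \<omega>) * (\<Prod>j<n. ennreal (exp (- \<theta> * Src (?s j) \<omega> j))) \<partial>M)"
  proof (rule nn_integral_cong)
    fix \<omega> assume "\<omega> \<in> space M"
    note h_chain[OF this]
    moreover have "ennreal (exp (- \<theta> * T n \<omega>)) = (\<Prod>j<n. ennreal (exp (- \<theta> * Src (?s j) \<omega> j)))"
      if "\<omega> \<in> path_event x k"
      using jump_time_on_path[OF that \<open>n \<le> k\<close>]
      by (simp add: prod_ennreal exp_sum[symmetric] sum_distrib_left sum_negf)
    ultimately show "indicator (path_event x k) \<omega> * ennreal (exp (- \<theta> * T n \<omega>)) =
        h (Src Embedded_Chain \<omega>) * (\<Prod>j<n. ennreal (exp (- \<theta> * Src (?s j) \<omega> j)))"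
      by (auto split: split_indicator)
  qed
  also have "\<dots> = (\<integral>\<^sup>+\<omega>. h (Src Embedded_Chain \<omega>) \<partial>M) *
      (\<Prod>j<n. \<integral>\<^sup>+\<omega>. ennreal (exp (- \<theta> * Src (?s j) \<omega> j)) \<partial>M)"
    by (rule nn_integral_product_over_sources[OF _ _ _ h_meas]) (auto simp: jump_source_def)
  also have "(\<integral>\<^sup>+\<omega>. h (Src Embedded_Chain \<omega>) \<partial>M) = (\<integral>\<^sup>+\<omega>. indicator (path_event x k) \<omega> \<partial>M)"
    by (intro nn_integral_cong h_chain)
  finally show ?thesis
    by (simp only: nn_integral_jump_source[OF \<open>\<theta> \<ge> 0\<close>]) simp
qed

lemma emeasure_path_Suc:
  "emeasure M (path_event x (Suc k)) =
    emeasure M (path_event x k) * ennreal (bd_transition p q (x k) (x (Suc k)))"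
proof -
  have eq: "{\<omega> \<in> space M. X (Suc k) \<omega> = x (Suc k) \<and> (\<forall>l\<le>k. X l \<omega> = x l)} = path_event x (Suc k)"
    unfolding path_event_def by (auto simp: le_Suc_eq)
  have "prob (path_event x (Suc k)) = prob (path_event x k) * bd_transition p q (x k) (x (Suc k))"
  proof (cases "prob (path_event x k) = 0")
    case True
    moreover have "prob (path_event x (Suc k)) \<le> prob (path_event x k)"
      by (intro finite_measure_mono path_event_sets) (auto simp: path_event_def)
    ultimately show ?thesis by (simp add: measure_le_0_iff)
  next
    case False
    then have "\<P>(\<omega> in M. \<forall>l\<le>k. X l \<omega> = x l) > 0"
      by (simp add: path_event_def zero_less_measure_iff)
    from X_markov[OF this, of "x (Suc k)"] False show ?thesis
      by (simp add: cond_prob_def eq path_event_def[symmetric] field_simps)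
  qed
  then show ?thesis
    by (simp add: emeasure_eq_measure ennreal_mult bd_transition_def p_nonneg q_nonneg)
qed

text \<open>There are only countably many finite paths, and those with a step other than \<open>\<plusminus>1\<close> are null.\<close>

lemma AE_unit_steps: "AE \<omega> in M. \<forall>k. X (Suc k) \<omega> = Suc (X k \<omega>) \<or> X k \<omega> = Suc (X (Suc k) \<omega>)"
proof -
  have null: "AE \<omega> in M. map (\<lambda>l. X l \<omega>) [0..<Suc (Suc k)] \<noteq> z"
    if bad: "\<not> (z ! Suc k = Suc (z ! k) \<or> z ! k = Suc (z ! Suc k))" for k and z :: "nat list"
  proof -
    have "emeasure M (path_event (\<lambda>l. z ! l) (Suc k)) = 0"
      using bad by (simp add: emeasure_path_Suc bd_transition_def)
    then have "AE \<omega> in M. \<omega> \<notin> path_event (\<lambda>l. z ! l) (Suc k)"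
      by (intro AE_not_in) (auto simp: null_sets_def)
    then show ?thesis
      using AE_space by eventually_elim (auto simp: path_event_def simp del: upt_Suc)
  qed
  have "AE \<omega> in M. \<forall>k (z :: nat list). \<not> (z ! Suc k = Suc (z ! k) \<or> z ! k = Suc (z ! Suc k)) \<longrightarrow>
      map (\<lambda>l. X l \<omega>) [0..<Suc (Suc k)] \<noteq> z"
    unfolding AE_all_countable using null by (auto simp del: upt_Suc)
  then show ?thesis
  proof eventually_elim
    case (elim \<omega>)
    show ?case
    proof
      fix k
      have "map (\<lambda>l. X l \<omega>) [0..<Suc (Suc k)] ! k = X k \<omega>"
        "map (\<lambda>l. X l \<omega>) [0..<Suc (Suc k)] ! Suc k = X (Suc k) \<omega>"
        by (simp_all del: upt_Suc)
      then show "X (Suc k) \<omega> = Suc (X k \<omega>) \<or> X k \<omega> = Suc (X (Suc k) \<omega>)"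
        using elim[rule_format, of "map (\<lambda>l. X l \<omega>) [0..<Suc (Suc k)]" k] by auto
    qed
  qed
qed

text \<open>
  The sub-Markovian transition operator that weights each jump by the Laplace transform of its
  waiting time. At \<open>i = 0\<close> the second summand vanishes because \<open>q 0 = 0\<close>.
\<close>

definition weighted_transition :: "real \<Rightarrow> (nat \<Rightarrow> ennreal) \<Rightarrow> nat \<Rightarrow> ennreal" where
  "weighted_transition \<theta> \<phi> i =
    ennreal (p i * right_laplace \<theta> i) * \<phi> (Suc i) + ennreal (q i * left_laplace \<theta> i) * \<phi> (i - 1)"

lemma one_step_on_path:
  assumes "\<theta> \<ge> 0"
  shows "(\<integral>\<^sup>+\<omega>. indicator (path_event x k) \<omega> * (\<phi> (X (Suc k) \<omega>) * ennreal (exp (- \<theta> * T (Suc k) \<omega>))) \<partial>M) =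
    (\<integral>\<^sup>+\<omega>. indicator (path_event x k) \<omega> *
      (weighted_transition \<theta> \<phi> (X k \<omega>) * ennreal (exp (- \<theta> * T k \<omega>))) \<partial>M)"
proof -
  let ?i = "x k"
  let ?W = "(\<integral>\<^sup>+\<omega>. indicator (path_event x k) \<omega> * ennreal (exp (- \<theta> * T k \<omega>)) \<partial>M)"
  have path_weight: "(\<lambda>\<omega>. indicator (path_event y n) \<omega> * ennreal (exp (- \<theta> * T n \<omega>))) \<in> borel_measurable M"
    for y n by measurable
  define up where "up = x(Suc k := Suc ?i)"
  define dn where "dn = x(Suc k := ?i - 1)"
  have next_path: "(\<integral>\<^sup>+\<omega>. indicator (path_event y (Suc k)) \<omega> * ennreal (exp (- \<theta> * T (Suc k) \<omega>)) \<partial>M) =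
      ?W * ennreal (bd_transition p q ?i j * jump_laplace \<theta> ?i j)"
    if "y = x(Suc k := j)" for y j
  proof -
    have "path_event y k = path_event x k" "y k = x k" "y (Suc k) = j"
      using that by (auto simp: path_event_def)
    have "(\<Prod>l<k. ennreal (jump_laplace \<theta> (y l) (y (Suc l)))) =
        (\<Prod>l<k. ennreal (jump_laplace \<theta> (x l) (x (Suc l))))"
      using that by (intro prod.cong) auto
    moreover have "ennreal (bd_transition p q ?i j * jump_laplace \<theta> ?i j) =
        ennreal (bd_transition p q ?i j) * ennreal (jump_laplace \<theta> ?i j)"
      using jump_laplace_nonneg[OF assms] p_nonneg q_nonneg
      by (intro ennreal_mult) (simp_all add: bd_transition_def)
    ultimately show ?thesis
      unfolding nn_integral_path[OF assms order_refl] emeasure_path_Suc prod.lessThan_Suc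
      by (simp only: \<open>path_event y k = path_event x k\<close> \<open>y k = x k\<close> \<open>y (Suc k) = j\<close> mult_ac)
  qed
  have "AE \<omega> in M. indicator (path_event x k) \<omega> * (\<phi> (X (Suc k) \<omega>) * ennreal (exp (- \<theta> * T (Suc k) \<omega>))) =
      \<phi> (Suc ?i) * (indicator (path_event up (Suc k)) \<omega> * ennreal (exp (- \<theta> * T (Suc k) \<omega>))) +
      \<phi> (?i - 1) * (indicator (path_event dn (Suc k)) \<omega> * ennreal (exp (- \<theta> * T (Suc k) \<omega>)))"
    using AE_unit_steps AE_space
  proof eventually_elim
    case (elim \<omega>)
    show ?case
    proof (cases "\<omega> \<in> path_event x k")
      case True
      then have "X k \<omega> = ?i" by (simp add: path_event_def)
      then have dir: "X (Suc k) \<omega> = Suc ?i \<or> X (Suc k) \<omega> = ?i - 1"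
        using elim(1)[rule_format, of k] by force
      have "\<omega> \<in> path_event (x(Suc k := j)) (Suc k) \<longleftrightarrow> X (Suc k) \<omega> = j" for j
        using True by (auto simp: path_event_def le_Suc_eq)
      then have "\<omega> \<in> path_event up (Suc k) \<longleftrightarrow> X (Suc k) \<omega> = Suc ?i"
        "\<omega> \<in> path_event dn (Suc k) \<longleftrightarrow> X (Suc k) \<omega> = ?i - 1"
        by (simp_all add: up_def dn_def)
      with dir True show ?thesis by (elim disjE) simp_all
    next
      case False
      then have "\<omega> \<notin> path_event up (Suc k)" "\<omega> \<notin> path_event dn (Suc k)"
        by (auto simp: path_event_def up_def dn_def le_Suc_eq)
      then show ?thesis using False by simp
    qed
  qed
  then have "(\<integral>\<^sup>+\<omega>. indicator (path_event x k) \<omega> * (\<phi> (X (Suc k) \<omega>) * ennreal (exp (- \<theta> * T (Suc k) \<omega>))) \<partial>M) =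
    (\<integral>\<^sup>+\<omega>. \<phi> (Suc ?i) * (indicator (path_event up (Suc k)) \<omega> * ennreal (exp (- \<theta> * T (Suc k) \<omega>))) +
      \<phi> (?i - 1) * (indicator (path_event dn (Suc k)) \<omega> * ennreal (exp (- \<theta> * T (Suc k) \<omega>))) \<partial>M)"
    by (rule nn_integral_cong_AE)
  also have "\<dots> =
      \<phi> (Suc ?i) * (?W * ennreal (bd_transition p q ?i (Suc ?i) * jump_laplace \<theta> ?i (Suc ?i))) +
      \<phi> (?i - 1) * (?W * ennreal (bd_transition p q ?i (?i - 1) * jump_laplace \<theta> ?i (?i - 1)))"
    by (simp only: nn_integral_add[OF borel_measurable_times_ennreal[OF borel_measurable_const path_weight]
          borel_measurable_times_ennreal[OF borel_measurable_const path_weight]]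
        nn_integral_cmult[OF path_weight] next_path[OF up_def] next_path[OF dn_def])
  also have "\<dots> = weighted_transition \<theta> \<phi> ?i * ?W"
  proof -
    have "bd_transition p q ?i (?i - 1) = q ?i" using q_0 by (cases ?i) (auto simp: bd_transition_def)
    moreover have "jump_laplace \<theta> ?i (?i - 1) = left_laplace \<theta> ?i" by (auto simp: jump_laplace_def)
    moreover have "bd_transition p q ?i (Suc ?i) = p ?i" "jump_laplace \<theta> ?i (Suc ?i) = right_laplace \<theta> ?i"
      by (auto simp: bd_transition_def jump_laplace_def)
    ultimately show ?thesis
      by (simp only: weighted_transition_def distrib_right distrib_left mult_ac)
  qed
  also have "\<dots> = (\<integral>\<^sup>+\<omega>. weighted_transition \<theta> \<phi> ?i *
      (indicator (path_event x k) \<omega> * ennreal (exp (- \<theta> * T k \<omega>))) \<partial>M)"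
    by (rule nn_integral_cmult[OF path_weight, symmetric])
  also have "\<dots> = (\<integral>\<^sup>+\<omega>. indicator (path_event x k) \<omega> *
      (weighted_transition \<theta> \<phi> (X k \<omega>) * ennreal (exp (- \<theta> * T k \<omega>))) \<partial>M)"
    by (intro nn_integral_cong) (auto simp: path_event_def mult_ac split: split_indicator)
  finally show ?thesis .
qed

lemma path_list_rv [measurable]:
  "random_variable (count_space UNIV) (\<lambda>\<omega>. map (\<lambda>l. X l \<omega>) [0..<n])"
proof (induction n)
  case (Suc n)
  note [measurable] = Suc
  show ?case by simp
qed simp

text \<open>
  The factor \<open>\<psi>\<close>, an arbitrary function of the path up to step \<open>k\<close>, makes this an identity between
  conditional expectations given that path.
\<close>

lemma one_step:
  assumes "\<theta> \<ge> 0"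
  shows "(\<integral>\<^sup>+\<omega>. \<psi> (map (\<lambda>l. X l \<omega>) [0..<Suc k]) * (\<phi> (X (Suc k) \<omega>) * ennreal (exp (- \<theta> * T (Suc k) \<omega>))) \<partial>M) =
    (\<integral>\<^sup>+\<omega>. \<psi> (map (\<lambda>l. X l \<omega>) [0..<Suc k]) *
      (weighted_transition \<theta> \<phi> (X k \<omega>) * ennreal (exp (- \<theta> * T k \<omega>))) \<partial>M)"
    (is "(\<integral>\<^sup>+\<omega>. \<psi> (?Z \<omega>) * ?U \<omega> \<partial>M) = (\<integral>\<^sup>+\<omega>. \<psi> (?Z \<omega>) * ?V \<omega> \<partial>M)")
proof (rule nn_integral_eq_by_fibres[where Z = ?Z])
  have [measurable]: "(\<lambda>\<omega>. \<psi> (?Z \<omega>)) \<in> borel_measurable M"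
    by (rule measurable_compose[OF path_list_rv]) simp
  show "(\<lambda>\<omega>. \<psi> (?Z \<omega>) * ?U \<omega>) \<in> borel_measurable M" "(\<lambda>\<omega>. \<psi> (?Z \<omega>) * ?V \<omega>) \<in> borel_measurable M"
    by measurable
  fix z :: "nat list"
  show "(\<integral>\<^sup>+\<omega>. indicator {z} (?Z \<omega>) * (\<psi> (?Z \<omega>) * ?U \<omega>) \<partial>M) =
      (\<integral>\<^sup>+\<omega>. indicator {z} (?Z \<omega>) * (\<psi> (?Z \<omega>) * ?V \<omega>) \<partial>M)"
  proof (cases "length z = Suc k")
    case True
    have ind: "indicator {z} (?Z \<omega>) = (indicator (path_event (\<lambda>l. z ! l) k) \<omega> :: ennreal)"
      if "\<omega> \<in> space M" for \<omega>
      using that True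
      by (auto simp: path_event_def list_eq_iff_nth_eq less_Suc_eq_le split: split_indicator simp del: upt_Suc)
    have *: "(\<integral>\<^sup>+\<omega>. indicator {z} (?Z \<omega>) * (\<psi> (?Z \<omega>) * W \<omega>) \<partial>M) =
        \<psi> z * (\<integral>\<^sup>+\<omega>. indicator (path_event (\<lambda>l. z ! l) k) \<omega> * W \<omega> \<partial>M)"
      if [measurable]: "W \<in> borel_measurable M" for W :: "'a \<Rightarrow> ennreal"
      by (subst nn_integral_cmult[symmetric], measurable, rule nn_integral_cong)
        (auto simp: ind[symmetric] split: split_indicator)
    have U: "?U \<in> borel_measurable M" and V: "?V \<in> borel_measurable M"
      by measurable
    show ?thesis
      unfolding *[OF U] *[OF V] one_step_on_path[OF assms] ..
  next
    case False
    then have "indicator {z} (?Z \<omega>) = (0::ennreal)" for \<omega>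
      by (intro indicator_simps(2)) (auto simp del: upt_Suc)
    then show ?thesis by (simp only: mult_zero_left)
  qed
qed simp

section \<open>Excessive and defective functions from the Poisson equation\<close>

text \<open>The mass lost by the weighted transition at \<open>i\<close>, that is \<open>1 - weighted_transition \<theta> 1 i\<close>.\<close>

definition laplace_defect :: "real \<Rightarrow> nat \<Rightarrow> real" where
  "laplace_defect \<theta> i = 1 - (p i * right_laplace \<theta> i + q i * left_laplace \<theta> i)"

lemma laplace_defect_1: "laplace_defect 1 i = 1 - wait_laplace M p q \<tau>p \<tau>m i"
  by (simp add: laplace_defect_def wait_laplace_def right_laplace_def left_laplace_def)

lemma laplace_defect_eq:
  "laplace_defect \<theta> i = p i * (1 - right_laplace \<theta> i) + q i * (1 - left_laplace \<theta> i)"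
  using p_plus_q[of i] by (simp add: laplace_defect_def algebra_simps)

lemma laplace_defect_nonneg: "\<theta> \<ge> 0 \<Longrightarrow> 0 \<le> laplace_defect \<theta> i"
  unfolding laplace_defect_eq using laplace_bounds p_nonneg q_nonneg by simp

lemma laplace_antimono:
  assumes "0 \<le> \<theta>" "\<theta> \<le> \<theta>'"
  shows "right_laplace \<theta>' i \<le> right_laplace \<theta> i" "left_laplace \<theta>' i \<le> left_laplace \<theta> i"
proof -
  have "(\<integral>\<omega>. exp (- \<theta>' * Y \<omega>) \<partial>M) \<le> (\<integral>\<omega>. exp (- \<theta> * Y \<omega>) \<partial>M)"
    if [measurable]: "random_variable borel Y" and pos: "AE \<omega> in M. Y \<omega> > (0::real)" for Y
  proof (rule integral_mono_AE)
    show "AE \<omega> in M. exp (- \<theta>' * Y \<omega>) \<le> exp (- \<theta> * Y \<omega>)"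
      using pos by eventually_elim (use assms in \<open>simp add: mult_right_mono\<close>)
  qed (rule laplace_props(1)[OF _ pos]; use assms in simp)+
  then show "right_laplace \<theta>' i \<le> right_laplace \<theta> i" "left_laplace \<theta>' i \<le> left_laplace \<theta> i"
    unfolding right_laplace_def left_laplace_def by (auto intro: \<tau>p_rv \<tau>m_rv \<tau>p_pos \<tau>m_pos)
qed

lemma laplace_defect_mono:
  assumes "0 \<le> \<theta>" "\<theta> \<le> \<theta>'"
  shows "laplace_defect \<theta> i \<le> laplace_defect \<theta>' i"
  unfolding laplace_defect_eq using laplace_antimono[OF assms] p_nonneg q_nonneg
  by (intro add_mono mult_left_mono) auto

lemma laplace_defect_tendsto_0:
  "(\<lambda>n. laplace_defect (1 / real (Suc n)) i) \<longlonglongrightarrow> 0"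
proof -
  have lim: "(\<lambda>n. \<integral>\<omega>. exp (- (1 / real (Suc n)) * Y \<omega>) \<partial>M) \<longlonglongrightarrow> 1"
    if [measurable]: "random_variable borel Y" and pos: "AE \<omega> in M. Y \<omega> > (0::real)" for Y
  proof -
    have "(\<lambda>n. \<integral>\<omega>. exp (- (1 / real (Suc n)) * Y \<omega>) \<partial>M) \<longlonglongrightarrow> (\<integral>\<omega>. 1 \<partial>M)"
    proof (rule integral_dominated_convergence[where w = "\<lambda>_. 1"])
      show "AE \<omega> in M. (\<lambda>n. exp (- (1 / real (Suc n)) * Y \<omega>)) \<longlonglongrightarrow> 1"
      proof (rule AE_I2)
        fix \<omega>
        have "(\<lambda>n. exp (- (1 / real (Suc n)) * Y \<omega>)) \<longlonglongrightarrow> exp (- 0 * Y \<omega>)"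
          by (intro tendsto_intros LIMSEQ_Suc[OF lim_1_over_n])
        then show "(\<lambda>n. exp (- (1 / real (Suc n)) * Y \<omega>)) \<longlonglongrightarrow> 1" by simp
      qed
      show "AE \<omega> in M. norm (exp (- (1 / real (Suc n)) * Y \<omega>)) \<le> 1" for n
        using pos by eventually_elim simp
    qed auto
    then show ?thesis by (simp add: prob_space)
  qed
  have "(\<lambda>n. laplace_defect (1 / real (Suc n)) i) \<longlonglongrightarrow> 1 - (p i * 1 + q i * 1)"
    unfolding laplace_defect_def right_laplace_def left_laplace_def
    by (intro tendsto_intros lim \<tau>p_rv \<tau>m_rv \<tau>p_pos \<tau>m_pos)
  then show ?thesis using p_plus_q[of i] by simp
qed

lemma weighted_transition_ennreal:
  assumes "\<theta> \<ge> 0" and "\<And>i. 0 \<le> f i"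
  shows "weighted_transition \<theta> (\<lambda>i. ennreal (f i)) i =
    ennreal (p i * right_laplace \<theta> i * f (Suc i) + q i * left_laplace \<theta> i * f (i - 1))"
  using laplace_bounds[OF assms(1), of i] p_nonneg[of i] q_nonneg[of i] assms(2)
  by (simp add: weighted_transition_def ennreal_mult ennreal_plus)

text \<open>
  Compared with the embedded chain, the weighted transition takes away at least the defect from a
  function that is at least \<open>1\<close>, and this is just what the embedded chain adds to the potential.
\<close>

lemma excessive_potential:
  assumes "\<theta> \<ge> 0"
  shows "weighted_transition \<theta> (\<lambda>i. ennreal (1 + bd_potential p q (laplace_defect \<theta>) i)) i
    \<le> ennreal (1 + bd_potential p q (laplace_defect \<theta>) i)"
proof -
  let ?u = "bd_potential p q (laplace_defect \<theta>)"
  let ?a = "right_laplace \<theta> i" and ?b = "left_laplace \<theta> i"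
  note u = bd_potential_nonneg[of "laplace_defect \<theta>", OF laplace_defect_nonneg[OF assms]]
  have a: "0 \<le> p i * (1 - ?a) * ?u (Suc i)" and b: "0 \<le> q i * (1 - ?b) * ?u (i - 1)"
    using laplace_bounds[OF assms, of i] u p_nonneg q_nonneg by simp_all
  have "p i * ?a * (1 + ?u (Suc i)) + q i * ?b * (1 + ?u (i - 1)) =
      (p i * ?u (Suc i) + q i * ?u (i - 1)) + (p i * ?a + q i * ?b)
      - (p i * (1 - ?a) * ?u (Suc i) + q i * (1 - ?b) * ?u (i - 1))"
    by (simp add: algebra_simps)
  also have "\<dots> \<le> (?u i + laplace_defect \<theta> i) + (1 - laplace_defect \<theta> i)"
    using a b unfolding bd_potential_Poisson laplace_defect_def by simp
  also have "\<dots> = 1 + ?u i" by simp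
  finally show ?thesis
    using weighted_transition_ennreal[OF assms, of "\<lambda>i. 1 + ?u i" i] u
    by (metis add_nonneg_nonneg ennreal_leI zero_le_one)
qed

text \<open>
  The same balance for a function that is at most \<open>1\<close>: the loss is then at most the defect. The
  assumption \<open>s \<le> 1\<close> makes the function nonnegative.
\<close>

lemma defective_potential:
  assumes "\<theta> \<ge> 0" and le: "\<And>i. bd_potential p q (laplace_defect \<theta>) i \<le> s" and "s \<le> 1"
  shows "ennreal (1 - s + bd_potential p q (laplace_defect \<theta>) i)
    \<le> weighted_transition \<theta> (\<lambda>i. ennreal (1 - s + bd_potential p q (laplace_defect \<theta>) i)) i"
proof -
  let ?u = "bd_potential p q (laplace_defect \<theta>)"
  let ?a = "right_laplace \<theta> i" and ?b = "left_laplace \<theta> i"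
  note u = bd_potential_nonneg[of "laplace_defect \<theta>", OF laplace_defect_nonneg[OF assms(1)]]
  have a: "0 \<le> p i * (1 - ?a) * (s - ?u (Suc i))" and b: "0 \<le> q i * (1 - ?b) * (s - ?u (i - 1))"
    using laplace_bounds[OF assms(1), of i] le p_nonneg q_nonneg by simp_all
  have pq: "p i * x + q i * x = x" for x
    using p_plus_q[of i] by (simp add: distrib_right[symmetric])
  have "1 - s + ?u i = (p i * ?u (Suc i) + q i * ?u (i - 1)) - laplace_defect \<theta> i + (p i * (1 - s) + q i * (1 - s))"
    unfolding bd_potential_Poisson pq by simp
  also have "\<dots> = p i * ?a * (1 - s + ?u (Suc i)) + q i * ?b * (1 - s + ?u (i - 1))
      - (p i * (1 - ?a) * (s - ?u (Suc i)) + q i * (1 - ?b) * (s - ?u (i - 1)))"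
    unfolding laplace_defect_eq by (simp add: algebra_simps)
  also have "\<dots> \<le> p i * ?a * (1 - s + ?u (Suc i)) + q i * ?b * (1 - s + ?u (i - 1))"
    using a b by simp
  finally have "1 - s + ?u i \<le> p i * ?a * (1 - s + ?u (Suc i)) + q i * ?b * (1 - s + ?u (i - 1))" .
  moreover have "0 \<le> 1 - s + ?u j" for j using u[of j] \<open>s \<le> 1\<close> by simp
  ultimately show ?thesis
    using weighted_transition_ennreal[OF assms(1), of "\<lambda>i. 1 - s + ?u i" i]
    by (metis ennreal_leI)
qed

section \<open>Divergent series: no explosion\<close>

text \<open>
  The process \<open>F (X k) * exp (- \<theta> * T k)\<close> stopped at the first visit of the embedded chain to \<open>N\<close>.
\<close>

primrec stopped_weight :: "real \<Rightarrow> nat \<Rightarrow> (nat \<Rightarrow> ennreal) \<Rightarrow> nat \<Rightarrow> 'a \<Rightarrow> ennreal" where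
  "stopped_weight \<theta> N F 0 \<omega> = F (X 0 \<omega>)"
| "stopped_weight \<theta> N F (Suc k) \<omega> =
    (if \<exists>l\<le>k. X l \<omega> = N then stopped_weight \<theta> N F k \<omega>
     else F (X (Suc k) \<omega>) * ennreal (exp (- \<theta> * T (Suc k) \<omega>)))"

lemma stopped_weight_measurable [measurable]: "stopped_weight \<theta> N F k \<in> borel_measurable M"
proof (induction k)
  case 0
  have "(\<lambda>\<omega>. stopped_weight \<theta> N F 0 \<omega>) \<in> borel_measurable M"
    unfolding stopped_weight.simps by (rule measurable_compose[OF X_rv]) simp
  then show ?case .
next
  case (Suc k)
  have "(\<lambda>\<omega>. F (X (Suc k) \<omega>)) \<in> borel_measurable M"
    by (rule measurable_compose[OF X_rv]) simp
  then have "(\<lambda>\<omega>. F (X (Suc k) \<omega>) * ennreal (exp (- \<theta> * T (Suc k) \<omega>))) \<in> borel_measurable M"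
    by (rule borel_measurable_times_ennreal) measurable
  moreover have "{\<omega> \<in> space M. \<exists>l\<le>k. X l \<omega> = N} \<in> events" by measurable
  ultimately have "(\<lambda>\<omega>. stopped_weight \<theta> N F (Suc k) \<omega>) \<in> borel_measurable M"
    unfolding stopped_weight.simps by (intro measurable_If Suc)
  then show ?case .
qed

lemma stopped_weight_before:
  assumes "\<forall>l<k. X l \<omega> \<noteq> N"
  shows "stopped_weight \<theta> N F k \<omega> = F (X k \<omega>) * ennreal (exp (- \<theta> * T k \<omega>))"
  using assms by (cases k) (auto simp: less_Suc_eq_le)

lemma stopped_weight_after:
  assumes "\<exists>l\<le>k. X l \<omega> = N"
  shows "\<exists>j\<le>k. stopped_weight \<theta> N F k \<omega> = F N * ennreal (exp (- \<theta> * T j \<omega>))"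
  using assms
proof (induction k)
  case 0
  then show ?case by simp
next
  case (Suc k)
  show ?case
  proof (cases "\<exists>l\<le>k. X l \<omega> = N")
    case True
    then have "stopped_weight \<theta> N F (Suc k) \<omega> = stopped_weight \<theta> N F k \<omega>" by simp
    with Suc.IH[OF True] show ?thesis by (metis le_SucI)
  next
    case False
    then have "X (Suc k) \<omega> = N" using Suc.prems by (auto simp: le_Suc_eq)
    then show ?thesis using False by (intro exI[of _ "Suc k"]) auto
  qed
qed

lemma stopped_weight_supermartingale:
  assumes "\<theta> \<ge> 0" and excessive: "\<And>i. weighted_transition \<theta> F i \<le> F i"
  shows "(\<integral>\<^sup>+\<omega>. indicator {x} (X 0 \<omega>) * stopped_weight \<theta> N F k \<omega> \<partial>M) \<le> F x"
proof (induction k)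
  case 0
  have "(\<integral>\<^sup>+\<omega>. indicator {x} (X 0 \<omega>) * stopped_weight \<theta> N F 0 \<omega> \<partial>M) \<le> (\<integral>\<^sup>+\<omega>. F x \<partial>M)"
    by (rule nn_integral_mono) (auto split: split_indicator)
  then show ?case by (simp add: emeasure_space_1)
next
  case (Suc k)
  define \<psi> :: "nat list \<Rightarrow> ennreal" where "\<psi> z = (if z ! 0 = x \<and> N \<notin> set z then 1 else 0)" for z
  have \<psi>: "\<psi> (map (\<lambda>l. X l \<omega>) [0..<Suc k]) = (if X 0 \<omega> = x \<and> (\<forall>l\<le>k. X l \<omega> \<noteq> N) then 1 else 0)" for \<omega>
  proof -
    have "map (\<lambda>l. X l \<omega>) [0..<Suc k] ! 0 = X 0 \<omega>" by (subst nth_map) (simp_all del: upt_Suc)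
    moreover have "N \<notin> set (map (\<lambda>l. X l \<omega>) [0..<Suc k]) \<longleftrightarrow> (\<forall>l\<le>k. X l \<omega> \<noteq> N)"
      by (auto simp: less_Suc_eq_le simp del: upt_Suc)
    ultimately show ?thesis unfolding \<psi>_def by simp
  qed
  \<comment> \<open>\<open>?R\<close> is the part already stopped at step \<open>k\<close>; \<open>\<psi>\<close> selects the paths that are still running.\<close>
  let ?R = "\<lambda>\<omega>. if X 0 \<omega> = x \<and> (\<exists>l\<le>k. X l \<omega> = N) then stopped_weight \<theta> N F k \<omega> else 0"
  have [measurable]: "(\<lambda>\<omega>. \<psi> (map (\<lambda>l. X l \<omega>) [0..<Suc k])) \<in> borel_measurable M"
    by (rule measurable_compose[OF path_list_rv]) simp
  have "(\<integral>\<^sup>+\<omega>. indicator {x} (X 0 \<omega>) * stopped_weight \<theta> N F (Suc k) \<omega> \<partial>M) =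
    (\<integral>\<^sup>+\<omega>. ?R \<omega> + \<psi> (map (\<lambda>l. X l \<omega>) [0..<Suc k]) * (F (X (Suc k) \<omega>) * ennreal (exp (- \<theta> * T (Suc k) \<omega>))) \<partial>M)"
    by (intro nn_integral_cong) (auto simp: \<psi> indicator_def simp del: upt_Suc)
  also have "\<dots> = (\<integral>\<^sup>+\<omega>. ?R \<omega> \<partial>M) +
      (\<integral>\<^sup>+\<omega>. \<psi> (map (\<lambda>l. X l \<omega>) [0..<Suc k]) * (F (X (Suc k) \<omega>) * ennreal (exp (- \<theta> * T (Suc k) \<omega>))) \<partial>M)"
    by (rule nn_integral_add) measurable
  also have "\<dots> = (\<integral>\<^sup>+\<omega>. ?R \<omega> \<partial>M) + (\<integral>\<^sup>+\<omega>. \<psi> (map (\<lambda>l. X l \<omega>) [0..<Suc k]) *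
      (weighted_transition \<theta> F (X k \<omega>) * ennreal (exp (- \<theta> * T k \<omega>))) \<partial>M)"
    unfolding one_step[OF assms(1)] ..
  also have "\<dots> \<le> (\<integral>\<^sup>+\<omega>. ?R \<omega> \<partial>M) + (\<integral>\<^sup>+\<omega>. \<psi> (map (\<lambda>l. X l \<omega>) [0..<Suc k]) *
      (F (X k \<omega>) * ennreal (exp (- \<theta> * T k \<omega>))) \<partial>M)"
    by (intro add_left_mono nn_integral_mono mult_left_mono mult_right_mono excessive) auto
  also have "\<dots> = (\<integral>\<^sup>+\<omega>. ?R \<omega> + \<psi> (map (\<lambda>l. X l \<omega>) [0..<Suc k]) *
      (F (X k \<omega>) * ennreal (exp (- \<theta> * T k \<omega>))) \<partial>M)"
    by (rule nn_integral_add[symmetric]) measurable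
  also have "\<dots> = (\<integral>\<^sup>+\<omega>. indicator {x} (X 0 \<omega>) * stopped_weight \<theta> N F k \<omega> \<partial>M)"
  proof (rule nn_integral_cong)
    fix \<omega>
    have "stopped_weight \<theta> N F k \<omega> = F (X k \<omega>) * ennreal (exp (- \<theta> * T k \<omega>))" if "\<forall>l\<le>k. X l \<omega> \<noteq> N"
      using that by (intro stopped_weight_before) auto
    then show "?R \<omega> + \<psi> (map (\<lambda>l. X l \<omega>) [0..<Suc k]) * (F (X k \<omega>) * ennreal (exp (- \<theta> * T k \<omega>))) =
        indicator {x} (X 0 \<omega>) * stopped_weight \<theta> N F k \<omega>"
      unfolding \<psi> by (auto simp: indicator_def)
  qed
  finally show ?case using Suc.IH by (rule order_trans)
qed

text \<open>
  A maximal inequality: where \<open>N\<close> is hit and the jump times stay below \<open>c\<close>, the stopped process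
  ends at a value of at least \<open>f N * exp (- \<theta> * c)\<close>.
\<close>

lemma prob_early_hit_le:
  assumes "\<theta> \<ge> 0" and excessive: "\<And>i. weighted_transition \<theta> (\<lambda>i. ennreal (f i)) i \<le> ennreal (f i)"
    and f: "\<And>i. f i > 0"
  shows "prob {\<omega> \<in> space M. X 0 \<omega> = x \<and> (\<forall>k. T k \<omega> \<le> c) \<and> (\<exists>l. X l \<omega> = N)}
    \<le> f x * exp (\<theta> * c) / f N"
proof -
  define A where "A k = {\<omega> \<in> space M. X 0 \<omega> = x \<and> (\<forall>k. T k \<omega> \<le> c) \<and> (\<exists>l\<le>k. X l \<omega> = N)}" for k
  have [measurable]: "A k \<in> events" for k unfolding A_def by measurable
  have "prob (A k) \<le> f x * exp (\<theta> * c) / f N" for k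
  proof -
    have "ennreal (prob (A k) * (f N * exp (- \<theta> * c))) = (\<integral>\<^sup>+\<omega>. ennreal (f N * exp (- \<theta> * c)) * indicator (A k) \<omega> \<partial>M)"
      using f[of N] by (subst nn_integral_cmult_indicator) (auto simp: emeasure_eq_measure ennreal_mult mult.commute)
    also have "\<dots> \<le> (\<integral>\<^sup>+\<omega>. indicator {x} (X 0 \<omega>) * stopped_weight \<theta> N (\<lambda>i. ennreal (f i)) k \<omega> \<partial>M)"
    proof (rule nn_integral_mono)
      fix \<omega>
      show "ennreal (f N * exp (- \<theta> * c)) * indicator (A k) \<omega> \<le>
          indicator {x} (X 0 \<omega>) * stopped_weight \<theta> N (\<lambda>i. ennreal (f i)) k \<omega>"
      proof (cases "\<omega> \<in> A k")
        case True
        then obtain j where j: "stopped_weight \<theta> N (\<lambda>i. ennreal (f i)) k \<omega> = ennreal (f N) * ennreal (exp (- \<theta> * T j \<omega>))"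
          unfolding A_def using stopped_weight_after[of k \<omega> N \<theta> "\<lambda>i. ennreal (f i)"] by auto
        have "T j \<omega> \<le> c" using True by (auto simp: A_def)
        then have "exp (- \<theta> * c) \<le> exp (- \<theta> * T j \<omega>)" using assms(1) by (simp add: mult_left_mono)
        then show ?thesis
          using True f[of N] unfolding j by (auto simp: A_def ennreal_mult intro!: mult_left_mono ennreal_leI)
      qed simp
    qed
    also have "\<dots> \<le> ennreal (f x)"
      by (rule stopped_weight_supermartingale[OF assms(1) excessive])
    finally have "prob (A k) * (f N * exp (- \<theta> * c)) \<le> f x"
      using f[of x] by (subst (asm) ennreal_le_iff) auto
    then show ?thesis
      using f[of N] by (simp add: field_simps exp_minus)
  qed
  moreover have "(\<lambda>k. prob (A k)) \<longlonglongrightarrow> prob (\<Union>k. A k)"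
    by (rule finite_Lim_measure_incseq) (auto simp: A_def incseq_def intro: order_trans)
  ultimately have "prob (\<Union>k. A k) \<le> f x * exp (\<theta> * c) / f N"
    by (intro LIMSEQ_le_const2[where X = "\<lambda>k. prob (A k)"]) auto
  moreover have "(\<Union>k. A k) = {\<omega> \<in> space M. X 0 \<omega> = x \<and> (\<forall>k. T k \<omega> \<le> c) \<and> (\<exists>l. X l \<omega> = N)}"
    unfolding A_def by auto
  ultimately show ?thesis by simp
qed

lemma AE_explodes_iff:
  "AE \<omega> in M. explodes X \<tau>ps \<tau>ms \<omega> \<longleftrightarrow> (\<forall>n. \<exists>k. n \<le> X k \<omega>) \<and> (\<exists>c. \<forall>k. T k \<omega> \<le> c)"
  using AE_unit_steps AE_waits_pos by eventually_elim (rule explodes_iff; blast)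

lemma prob_confined_explosion:
  assumes div: "\<not> summable (bd_green p q (laplace_defect 1))"
  shows "prob {\<omega> \<in> space M. X 0 \<omega> = x \<and> (\<forall>k. T k \<omega> \<le> c) \<and> (\<forall>n. \<exists>k. n \<le> X k \<omega>)} = 0"
    (is "prob ?B = 0")
proof (rule ccontr)
  assume "prob ?B \<noteq> 0"
  then have pos: "prob ?B > 0" by (simp add: zero_less_measure_iff)
  let ?u = "bd_potential p q (laplace_defect 1)"
  note defect_nonneg = laplace_defect_nonneg[of 1, simplified]
  have "1 + ?u N \<le> (1 + ?u x) * exp c / prob ?B" if "x \<le> N" for N
  proof -
    have gt0: "1 + ?u i > 0" for i
      using bd_potential_nonneg[of "laplace_defect 1" i] defect_nonneg by (simp add: add_pos_nonneg)
    have "prob ?B \<le> prob {\<omega> \<in> space M. X 0 \<omega> = x \<and> (\<forall>k. T k \<omega> \<le> c) \<and> (\<exists>l. X l \<omega> = N)}"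
    proof (rule finite_measure_mono_AE)
      show "AE \<omega> in M. \<omega> \<in> ?B \<longrightarrow> \<omega> \<in> {\<omega> \<in> space M. X 0 \<omega> = x \<and> (\<forall>k. T k \<omega> \<le> c) \<and> (\<exists>l. X l \<omega> = N)}"
        using AE_unit_steps
      proof eventually_elim
        case (elim \<omega>)
        have "X (Suc k) \<omega> \<le> Suc (X k \<omega>)" for k using elim[rule_format, of k] by auto
        from skip_free_hits_level[of "\<lambda>k. X k \<omega>", OF this] show ?case
          using that by blast
      qed
    qed measurable
    also have "\<dots> \<le> (1 + ?u x) * exp (1 * c) / (1 + ?u N)"
      by (rule prob_early_hit_le[OF _ excessive_potential gt0]) simp_all
    finally show ?thesis
      using pos gt0[of N] by (simp add: field_simps)
  qed
  then have bound: "?u N \<le> (1 + ?u x) * exp c / prob ?B" if "x \<le> N" for N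
    using that by (smt (verit))
  have "?u n \<le> (1 + ?u x) * exp c / prob ?B" for n
    using bound[of "max x n"] bd_potential_mono[of "laplace_defect 1" n "max x n"] defect_nonneg by simp
  then have "summable (bd_green p q (laplace_defect 1))"
    unfolding bd_potential_def
    by (intro summableI_nonneg_bounded[where x = "(1 + ?u x) * exp c / prob ?B"])
      (auto simp: bd_potential_def intro: bd_green_nonneg defect_nonneg)
  with div show False ..
qed

lemma AE_not_explodes:
  assumes "\<not> summable (bd_green p q (laplace_defect 1))"
  shows "AE \<omega> in M. \<not> explodes X \<tau>ps \<tau>ms \<omega>"
proof -
  have "AE \<omega> in M. \<not> (X 0 \<omega> = x \<and> (\<forall>k. T k \<omega> \<le> real c) \<and> (\<forall>n. \<exists>k. n \<le> X k \<omega>))" for x c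
  proof -
    have "{\<omega> \<in> space M. X 0 \<omega> = x \<and> (\<forall>k. T k \<omega> \<le> real c) \<and> (\<forall>n. \<exists>k. n \<le> X k \<omega>)} \<in> null_sets M"
      using prob_confined_explosion[OF assms] by (intro null_setsI) (auto simp: emeasure_eq_measure)
    from AE_not_in[OF this] show ?thesis
      using AE_space by eventually_elim blast
  qed
  then have "AE \<omega> in M. \<forall>x c. \<not> (X 0 \<omega> = x \<and> (\<forall>k. T k \<omega> \<le> real c) \<and> (\<forall>n. \<exists>k. n \<le> X k \<omega>))"
    by (intro AE_all_countable[THEN iffD2] allI)
  with AE_explodes_iff show ?thesis
  proof eventually_elim
    case (elim \<omega>)
    show ?case
    proof
      assume "explodes X \<tau>ps \<tau>ms \<omega>"
      then obtain c where c: "\<And>k. T k \<omega> \<le> c" and unbounded: "\<forall>n. \<exists>k. n \<le> X k \<omega>"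
        using elim(1) by blast
      obtain m :: nat where "c \<le> real m" using real_arch_simple by blast
      then have "\<forall>k. T k \<omega> \<le> real m" using c order_trans by blast
      then show False using elim(2) unbounded by blast
    qed
  qed
qed

section \<open>Convergent series: explosion\<close>

lemma nn_integral_exp_jump_time_ge:
  assumes "\<theta> \<ge> 0" and le: "\<And>i. bd_potential p q (laplace_defect \<theta>) i \<le> s" and "s \<le> 1"
  shows "ennreal (1 - s) \<le> (\<integral>\<^sup>+\<omega>. ennreal (exp (- \<theta> * T k \<omega>)) \<partial>M)"
proof -
  let ?u = "bd_potential p q (laplace_defect \<theta>)"
  let ?H = "\<lambda>i. ennreal (1 - s + ?u i)"
  have u: "0 \<le> ?u i" for i
    by (intro bd_potential_nonneg laplace_defect_nonneg assms)
  have "ennreal (1 - s) \<le> (\<integral>\<^sup>+\<omega>. ?H (X k \<omega>) * ennreal (exp (- \<theta> * T k \<omega>)) \<partial>M)"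
  proof (induction k)
    case 0
    have "ennreal (1 - s) = (\<integral>\<^sup>+\<omega>. ennreal (1 - s) \<partial>M)"
      by (simp add: emeasure_space_1)
    also have "\<dots> \<le> (\<integral>\<^sup>+\<omega>. ?H (X 0 \<omega>) * ennreal (exp (- \<theta> * T 0 \<omega>)) \<partial>M)"
      using u by (intro nn_integral_mono) (auto intro!: ennreal_leI)
    finally show ?case .
  next
    case (Suc k)
    note Suc
    also have "(\<integral>\<^sup>+\<omega>. ?H (X k \<omega>) * ennreal (exp (- \<theta> * T k \<omega>)) \<partial>M) \<le>
        (\<integral>\<^sup>+\<omega>. weighted_transition \<theta> ?H (X k \<omega>) * ennreal (exp (- \<theta> * T k \<omega>)) \<partial>M)"
      by (intro nn_integral_mono mult_right_mono defective_potential assms) simp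
    also have "\<dots> = (\<integral>\<^sup>+\<omega>. ?H (X (Suc k) \<omega>) * ennreal (exp (- \<theta> * T (Suc k) \<omega>)) \<partial>M)"
      using one_step[OF assms(1), of "\<lambda>_. 1" k ?H] by (simp only: mult_1_left)
    finally show ?case .
  qed
  also have "\<dots> \<le> (\<integral>\<^sup>+\<omega>. ennreal (exp (- \<theta> * T k \<omega>)) \<partial>M)"
  proof (rule nn_integral_mono)
    fix \<omega>
    have "?H (X k \<omega>) \<le> 1" using le[of "X k \<omega>"] by (simp add: ennreal_le_1)
    then show "?H (X k \<omega>) * ennreal (exp (- \<theta> * T k \<omega>)) \<le> ennreal (exp (- \<theta> * T k \<omega>))"
      using mult_right_mono[of "?H (X k \<omega>)" 1 "ennreal (exp (- \<theta> * T k \<omega>))"] by (simp only: mult_1_left) simp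
  qed
  finally show ?thesis .
qed

text \<open>Where the jump times are unbounded, \<open>exp (- \<theta> * T k)\<close> decreases to \<open>0\<close>.\<close>

lemma prob_jump_times_bounded_ge:
  assumes "\<theta> > 0" and le: "\<And>i. bd_potential p q (laplace_defect \<theta>) i \<le> s"
  shows "1 - s \<le> prob {\<omega> \<in> space M. \<exists>c::nat. \<forall>k. T k \<omega> \<le> real c}" (is "_ \<le> prob ?B")
proof (cases "s \<le> 1")
  case True
  have [measurable]: "?B \<in> events" by measurable
  have T_mono: "AE \<omega> in M. T k \<omega> \<le> T (Suc k) \<omega>" for k
    using AE_waits_pos by eventually_elim (auto simp: jump_time.simps less_imp_le)
  have "ennreal (1 - s) \<le> (INF k. \<integral>\<^sup>+\<omega>. ennreal (exp (- \<theta> * T k \<omega>)) \<partial>M)"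
    using nn_integral_exp_jump_time_ge[OF _ le True] assms(1) by (intro INF_greatest) simp
  also have "\<dots> = (\<integral>\<^sup>+\<omega>. (INF k. ennreal (exp (- \<theta> * T k \<omega>))) \<partial>M)"
  proof (rule nn_integral_monotone_convergence_INF_AE'[symmetric])
    show "AE \<omega> in M. ennreal (exp (- \<theta> * T (Suc k) \<omega>)) \<le> ennreal (exp (- \<theta> * T k \<omega>))" for k
      using T_mono[of k] by eventually_elim (use assms(1) in \<open>simp add: mult_left_mono ennreal_leI\<close>)
    show "(\<integral>\<^sup>+\<omega>. ennreal (exp (- \<theta> * T 0 \<omega>)) \<partial>M) < \<infinity>"
      by (simp add: emeasure_space_1)
  qed measurable
  also have "\<dots> \<le> (\<integral>\<^sup>+\<omega>. indicator ?B \<omega> \<partial>M)"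
  proof (rule nn_integral_mono)
    fix \<omega> assume "\<omega> \<in> space M"
    show "(INF k. ennreal (exp (- \<theta> * T k \<omega>))) \<le> indicator ?B \<omega>"
    proof (cases "\<omega> \<in> ?B")
      case True
      have "(INF k. ennreal (exp (- \<theta> * T k \<omega>))) \<le> ennreal (exp (- \<theta> * T 0 \<omega>))"
        by (rule INF_lower) simp
      then show ?thesis using True by simp
    next
      case False
      have small: "(INF k. ennreal (exp (- \<theta> * T k \<omega>))) \<le> 0 + ennreal e" if "e > 0" for e
      proof -
        obtain c :: nat where c: "- ln e / \<theta> \<le> real c" using real_arch_simple by blast
        obtain k where "real c < T k \<omega>" using False \<open>\<omega> \<in> space M\<close> by (auto simp: not_le)
        with c have "- ln e / \<theta> < T k \<omega>" by simp
        then have "- \<theta> * T k \<omega> \<le> ln e" using assms(1) by (simp add: field_simps)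
        then have "exp (- \<theta> * T k \<omega>) \<le> e" using that by (metis exp_le_cancel_iff exp_ln)
        then have "ennreal (exp (- \<theta> * T k \<omega>)) \<le> 0 + ennreal e"
          unfolding add_0_left by (rule ennreal_leI)
        then show ?thesis by (rule INF_lower2[OF UNIV_I])
      qed
      have "(INF k. ennreal (exp (- \<theta> * T k \<omega>))) \<le> 0"
        by (rule ennreal_le_epsilon) (rule small)
      then show ?thesis by simp
    qed
  qed
  also have "\<dots> = ennreal (prob ?B)" by (simp add: emeasure_eq_measure)
  finally show ?thesis by simp
next
  case False
  then show ?thesis using measure_nonneg[of M ?B] by linarith
qed

text \<open>
  The previous bound is used along \<open>\<theta> = 1 / (n + 1)\<close>. The terms of the series increase with \<open>\<theta>\<close>, so
  the convergent series for \<open>\<theta> = 1\<close> dominates all of them.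
\<close>

lemma AE_jump_times_bounded:
  assumes summable: "summable (bd_green p q (laplace_defect 1))"
  shows "AE \<omega> in M. \<exists>c. \<forall>k. T k \<omega> \<le> c"
proof -
  define \<theta> where "\<theta> n = 1 / real (Suc n)" for n
  have \<theta>: "0 < \<theta> n" "\<theta> n \<le> 1" for n by (simp_all add: \<theta>_def)
  have nonneg: "0 \<le> bd_green p q (laplace_defect (\<theta> n)) k" for n k
    using \<theta>[of n] by (intro bd_green_nonneg laplace_defect_nonneg) simp
  have le: "bd_green p q (laplace_defect (\<theta> n)) k \<le> bd_green p q (laplace_defect 1) k" for n k
    using \<theta>[of n] by (intro bd_green_mono laplace_defect_mono) simp_all
  have summable_n: "summable (bd_green p q (laplace_defect (\<theta> n)))" for n
    by (rule summable_comparison_test'[OF summable]) (use nonneg le in auto)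
  define s where "s n = (\<Sum>k. bd_green p q (laplace_defect (\<theta> n)) k)" for n
  have "s \<longlonglongrightarrow> (\<Sum>k. 0)"
  proof -
    have "(\<lambda>n. bd_green p q (laplace_defect (\<theta> n)) k) \<longlonglongrightarrow> 0" for k
      using tendsto_bd_green[of "\<lambda>n. laplace_defect (\<theta> n)" "\<lambda>_. 0" sequentially p q k]
        laplace_defect_tendsto_0 by (simp add: \<theta>_def bd_green_def)
    moreover have "eventually (\<lambda>(k, n). norm (bd_green p q (laplace_defect (\<theta> n)) k) \<le>
        bd_green p q (laplace_defect 1) k) (at_top \<times>\<^sub>F sequentially)"
      using nonneg le by (intro always_eventually) auto
    ultimately show ?thesis
      unfolding s_def[abs_def]
      using tannerys_theorem[OF _ _ summable, of "\<lambda>k n. bd_green p q (laplace_defect (\<theta> n)) k" "\<lambda>_. 0" sequentially]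
      by simp
  qed
  then have "(\<lambda>n. 1 - s n) \<longlonglongrightarrow> 1 - 0" by (intro tendsto_intros) simp
  let ?B = "{\<omega> \<in> space M. \<exists>c::nat. \<forall>k. T k \<omega> \<le> real c}"
  have "1 - s n \<le> prob ?B" for n
  proof (rule prob_jump_times_bounded_ge[OF \<theta>(1)])
    show "bd_potential p q (laplace_defect (\<theta> n)) i \<le> s n" for i
      unfolding bd_potential_def s_def by (intro sum_le_suminf summable_n) (auto intro: nonneg)
  qed
  with \<open>(\<lambda>n. 1 - s n) \<longlonglongrightarrow> 1 - 0\<close> have "1 \<le> prob ?B"
    using LIMSEQ_le_const2[of "\<lambda>n. 1 - s n" "1 - 0" "prob ?B"] by simp
  then have "prob ?B = 1" using prob_le_1[of ?B] by linarith
  then have "AE \<omega> in M. \<omega> \<in> ?B" by (rule AE_in_set_eq_1[THEN iffD2, rotated]) measurable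
  then show ?thesis by eventually_elim blast
qed

text \<open>
  This needs no convergence of the series. For \<open>\<theta> = 0\<close> the weights are \<open>1\<close>. With \<open>P v - v = 1\<close>, the function
  \<open>\<phi>\<close>, equal to \<open>v (N + 1) - v\<close> up to \<open>N\<close> and to \<open>0\<close> beyond, satisfies \<open>P \<phi> = \<phi> - 1 \<le> r * \<phi>\<close> on \<open>{0..N}\<close>
  with \<open>r = 1 - 1 / v (N + 1)\<close>, since \<open>\<phi> \<le> v (N + 1)\<close>.
\<close>

lemma AE_exceeds_level: "AE \<omega> in M. \<exists>k. N < X k \<omega>"
proof -
  define v where "v = bd_potential p q (\<lambda>_. 1)"
  define c where "c = bd_green p q (\<lambda>_. 1) N"
  define \<phi> where "\<phi> i = (if i \<le> N then v (Suc N) - v i else 0)" for i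
  have c: "c > 0" unfolding c_def by (rule bd_green_gt_0) simp
  have v_mono: "v i \<le> v j" if "i \<le> j" for i j
    unfolding v_def using that by (intro bd_potential_mono) auto
  have v_nonneg: "0 \<le> v i" for i unfolding v_def by (rule bd_potential_nonneg) simp
  have v_Suc: "v (Suc N) = v N + c" by (simp add: v_def c_def bd_potential_Suc)
  have v_pos: "v (Suc N) > 0" using v_Suc c v_nonneg[of N] by simp
  have \<phi>_ge: "c \<le> \<phi> i" if "i \<le> N" for i using that v_mono[OF that] v_Suc by (simp add: \<phi>_def)
  have \<phi>_le: "\<phi> i \<le> v (Suc N)" for i using v_nonneg by (simp add: \<phi>_def)
  have \<phi>_nonneg: "0 \<le> \<phi> i" for i using \<phi>_ge[of i] c by (cases "i \<le> N") (auto simp: \<phi>_def)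
  define r where "r = 1 - 1 / v (Suc N)"
  have step: "weighted_transition 0 (\<lambda>i. ennreal (\<phi> i)) i \<le> ennreal (r * \<phi> i)" if "i \<le> N" for i
  proof -
    have 1: "right_laplace 0 i = 1" "left_laplace 0 i = 1"
      by (simp_all add: right_laplace_def left_laplace_def prob_space)
    have \<phi>_eq: "\<phi> j = v (Suc N) - v j" if "j \<le> Suc N" for j
      using that by (cases "j = Suc N") (auto simp: \<phi>_def)
    have "p i * \<phi> (Suc i) + q i * \<phi> (i - 1) =
        (p i + q i) * v (Suc N) - (p i * v (Suc i) + q i * v (i - 1))"
      using \<open>i \<le> N\<close> by (simp add: \<phi>_eq algebra_simps)
    also have "\<dots> = \<phi> i - 1"
      unfolding v_def bd_potential_Poisson p_plus_q using \<open>i \<le> N\<close> by (simp add: \<phi>_def v_def)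
    also have "\<dots> \<le> r * \<phi> i"
      using \<phi>_le[of i] v_pos by (simp add: r_def field_simps)
    finally show ?thesis
      using \<phi>_nonneg by (subst weighted_transition_ennreal) (auto simp: 1 intro!: ennreal_leI)
  qed
  have r: "0 \<le> r" "r < 1"
  proof -
    show "r < 1" using v_pos by (simp add: r_def)
    have "1 \<le> v (Suc 0)" by (simp add: v_def bd_potential_def bd_green_0)
    also have "\<dots> \<le> v (Suc N)" by (rule v_mono) simp
    finally show "0 \<le> r" by (simp add: r_def)
  qed
  define G where "G k = {\<omega> \<in> space M. \<forall>l\<le>k. X l \<omega> \<le> N}" for k
  have [measurable]: "G k \<in> events" for k unfolding G_def by measurable
  have decay: "(\<integral>\<^sup>+\<omega>. indicator (G k) \<omega> * ennreal (\<phi> (X k \<omega>)) \<partial>M) \<le> ennreal (r ^ k * v (Suc N))" for k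
  proof (induction k)
    case 0
    have "(\<integral>\<^sup>+\<omega>. indicator (G 0) \<omega> * ennreal (\<phi> (X 0 \<omega>)) \<partial>M) \<le> (\<integral>\<^sup>+\<omega>. ennreal (v (Suc N)) \<partial>M)"
      using \<phi>_le by (intro nn_integral_mono) (auto split: split_indicator intro: ennreal_leI)
    then show ?case by (simp add: emeasure_space_1)
  next
    case (Suc k)
    define \<psi> :: "nat list \<Rightarrow> ennreal" where "\<psi> z = (if \<forall>y\<in>set z. y \<le> N then 1 else 0)" for z
    have \<psi>: "\<psi> (map (\<lambda>l. X l \<omega>) [0..<Suc k]) = indicator (G k) \<omega>" if "\<omega> \<in> space M" for \<omega>
      using that by (auto simp: \<psi>_def G_def less_Suc_eq_le split: split_indicator simp del: upt_Suc)
    have "(\<integral>\<^sup>+\<omega>. indicator (G (Suc k)) \<omega> * ennreal (\<phi> (X (Suc k) \<omega>)) \<partial>M) =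
        (\<integral>\<^sup>+\<omega>. \<psi> (map (\<lambda>l. X l \<omega>) [0..<Suc k]) * (ennreal (\<phi> (X (Suc k) \<omega>)) * ennreal (exp (- 0 * T (Suc k) \<omega>))) \<partial>M)"
    proof (rule nn_integral_cong)
      fix \<omega> assume "\<omega> \<in> space M"
      then have "\<omega> \<in> G (Suc k) \<longleftrightarrow> \<omega> \<in> G k \<and> X (Suc k) \<omega> \<le> N" by (auto simp: G_def le_Suc_eq)
      moreover have "\<phi> (X (Suc k) \<omega>) = 0" if "\<not> X (Suc k) \<omega> \<le> N" using that by (simp add: \<phi>_def)
      ultimately show "indicator (G (Suc k)) \<omega> * ennreal (\<phi> (X (Suc k) \<omega>)) = \<psi> (map (\<lambda>l. X l \<omega>) [0..<Suc k]) *
          (ennreal (\<phi> (X (Suc k) \<omega>)) * ennreal (exp (- 0 * T (Suc k) \<omega>)))"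
        unfolding \<psi>[OF \<open>\<omega> \<in> space M\<close>] by (auto split: split_indicator)
    qed
    also have "\<dots> = (\<integral>\<^sup>+\<omega>. \<psi> (map (\<lambda>l. X l \<omega>) [0..<Suc k]) *
        (weighted_transition 0 (\<lambda>i. ennreal (\<phi> i)) (X k \<omega>) * ennreal (exp (- 0 * T k \<omega>))) \<partial>M)"
      by (rule one_step) simp
    also have "\<dots> \<le> (\<integral>\<^sup>+\<omega>. ennreal r * (indicator (G k) \<omega> * ennreal (\<phi> (X k \<omega>))) \<partial>M)"
    proof (rule nn_integral_mono)
      fix \<omega> assume "\<omega> \<in> space M"
      have "X k \<omega> \<le> N" if "\<omega> \<in> G k" using that by (simp add: G_def)
      then show "\<psi> (map (\<lambda>l. X l \<omega>) [0..<Suc k]) *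
          (weighted_transition 0 (\<lambda>i. ennreal (\<phi> i)) (X k \<omega>) * ennreal (exp (- 0 * T k \<omega>)))
          \<le> ennreal r * (indicator (G k) \<omega> * ennreal (\<phi> (X k \<omega>)))"
        unfolding \<psi>[OF \<open>\<omega> \<in> space M\<close>] using step[of "X k \<omega>"] r \<phi>_nonneg
        by (auto simp: ennreal_mult split: split_indicator)
    qed
    also have "\<dots> = ennreal r * (\<integral>\<^sup>+\<omega>. indicator (G k) \<omega> * ennreal (\<phi> (X k \<omega>)) \<partial>M)"
      by (rule nn_integral_cmult) measurable
    also have "\<dots> \<le> ennreal r * ennreal (r ^ k * v (Suc N))"
      by (rule mult_left_mono[OF Suc]) simp
    also have "\<dots> = ennreal (r ^ Suc k * v (Suc N))"
      using r v_pos by (simp add: ennreal_mult[symmetric] mult.assoc)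
    finally show ?case .
  qed
  define B where "B = {\<omega> \<in> space M. \<forall>k. X k \<omega> \<le> N}"
  have [measurable]: "B \<in> events" unfolding B_def by measurable
  have "prob B * c \<le> r ^ k * v (Suc N)" for k
  proof -
    have "ennreal (prob B * c) = (\<integral>\<^sup>+\<omega>. ennreal c * indicator B \<omega> \<partial>M)"
      using c by (subst nn_integral_cmult_indicator) (auto simp: emeasure_eq_measure ennreal_mult mult.commute)
    also have "\<dots> \<le> (\<integral>\<^sup>+\<omega>. indicator (G k) \<omega> * ennreal (\<phi> (X k \<omega>)) \<partial>M)"
      using \<phi>_ge by (intro nn_integral_mono) (auto simp: B_def G_def split: split_indicator intro!: ennreal_leI)
    also note decay[of k]
    finally show ?thesis using r v_pos by (subst (asm) ennreal_le_iff) auto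
  qed
  moreover have "(\<lambda>k. r ^ k * v (Suc N)) \<longlonglongrightarrow> 0"
    using r by (intro tendsto_mult_left_zero LIMSEQ_power_zero) simp
  ultimately have "prob B * c \<le> 0"
    by (intro LIMSEQ_le_const[where X = "\<lambda>k. r ^ k * v (Suc N)"]) auto
  then have "prob B = 0"
    using c measure_nonneg[of M B] by (simp add: mult_le_0_iff)
  then have "B \<in> null_sets M" by (intro null_setsI) (auto simp: emeasure_eq_measure)
  from AE_not_in[OF this] show ?thesis
    using AE_space by eventually_elim (auto simp: B_def not_le)
qed

lemma AE_explodes:
  assumes "summable (bd_green p q (laplace_defect 1))"
  shows "AE \<omega> in M. explodes X \<tau>ps \<tau>ms \<omega>"
proof -
  have "AE \<omega> in M. \<forall>N. \<exists>k. N < X k \<omega>"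
    using AE_exceeds_level by (intro AE_all_countable[THEN iffD2] allI)
  with AE_explodes_iff AE_jump_times_bounded[OF assms] show ?thesis
    by eventually_elim (blast intro: less_imp_le)
qed

lemma explodes_event: "{\<omega> \<in> space M. explodes X \<tau>ps \<tau>ms \<omega>} \<in> events"
  using explodes_measurable[OF X_rv \<tau>ps_rv \<tau>ms_rv] by measurable

section \<open>The alternative\<close>

lemma explosion_alternative:
  "(\<P>(\<omega> in M. explodes X \<tau>ps \<tau>ms \<omega>) = 1 \<longleftrightarrow> (\<Sum>k. ennreal (bd_green p q (laplace_defect 1) k)) < \<infinity>) \<and>
   (\<P>(\<omega> in M. explodes X \<tau>ps \<tau>ms \<omega>) = 0 \<longleftrightarrow> (\<Sum>k. ennreal (bd_green p q (laplace_defect 1) k)) = \<infinity>)"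
proof -
  have nonneg: "0 \<le> bd_green p q (laplace_defect 1) k" for k
    by (intro bd_green_nonneg laplace_defect_nonneg) simp
  have summable_iff: "(\<Sum>k. ennreal (bd_green p q (laplace_defect 1) k)) < \<infinity> \<longleftrightarrow>
      summable (bd_green p q (laplace_defect 1))"
    unfolding infinity_ennreal_def less_top[symmetric]
    by (rule iffI) (rule summable_suminf_not_top[OF nonneg], assumption,
        rule ennreal_suminf_neq_top[OF _ nonneg])
  show ?thesis
  proof (cases "summable (bd_green p q (laplace_defect 1))")
    case True
    have "\<P>(\<omega> in M. explodes X \<tau>ps \<tau>ms \<omega>) = 1"
      using AE_explodes[OF True] explodes_event by (intro prob_Collect_eq_1[THEN iffD2])
    then show ?thesis using True summable_iff by auto
  next
    case False
    have "\<P>(\<omega> in M. explodes X \<tau>ps \<tau>ms \<omega>) = 0"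
      using AE_not_explodes[OF False] explodes_event by (intro prob_Collect_eq_0[THEN iffD2])
    then show ?thesis using False summable_iff by (auto simp: less_top[symmetric])
  qed
qed

end

theorem theorem3p1:
  fixes M :: "'a measure"
    and p q :: "nat \<Rightarrow> real"
    and X :: "nat \<Rightarrow> 'a \<Rightarrow> nat"
    and \<tau>p \<tau>m :: "nat \<Rightarrow> 'a \<Rightarrow> real"
    and \<tau>ps \<tau>ms :: "nat \<Rightarrow> nat \<Rightarrow> 'a \<Rightarrow> real"
  assumes "birth_death_ctrw M p q X \<tau>p \<tau>m \<tau>ps \<tau>ms"
  shows "(\<P>(\<omega> in M. explodes X \<tau>ps \<tau>ms \<omega>) = 1 \<longleftrightarrow>
            (\<Sum>k. ennreal ((\<Sum>i\<le>k. bd_speed M p q \<tau>p \<tau>m i) * bd_scale p q k)) < \<infinity>) \<and>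
         (\<P>(\<omega> in M. explodes X \<tau>ps \<tau>ms \<omega>) = 0 \<longleftrightarrow>
            (\<Sum>k. ennreal ((\<Sum>i\<le>k. bd_speed M p q \<tau>p \<tau>m i) * bd_scale p q k)) = \<infinity>)"
proof -
  interpret birth_death_ctrw M p q X \<tau>p \<tau>m \<tau>ps \<tau>ms by (rule assms)
  have "laplace_defect 1 = (\<lambda>i. 1 - wait_laplace M p q \<tau>p \<tau>m i)"
    by (rule ext) (rule laplace_defect_1)
  with explosion_alternative show ?thesis
    by (simp only: sum_speed_times_scale_eq_green)
qed

end
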